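(* Let $d\ge 1$, let $A\in GL_d(\mathbb{Q})$ have no (complex) eigenvalue of norm $1$, and let $G=\mathbb{Z}\ltimes_A H$, where $H\subset\mathbb{Q}^d$ is a subgroup with $A(H)=H$ and $\mathrm{rank}_{\mathbb{Q}}(H)=d$; let $a$ be the generator of the factor $\mathbb{Z}$. Assume that $G$ acts by orientation-preserving homeomorphisms of $[0,1]$ with no global fixed point in $(0,1)$. Then one of the following holds: either there exists $b\in H$ fixing no point in $(0,1)$, in which case the action of $G$ is semiconjugate to that of an affine group; or $H$ has a global fixed point in $(0,1)$, in which case the element $a\in G$ acts without fixed points inside $(0,1)$.
   Context: The $\mathbb{Q}$-rank of $H$, $\mathrm{rank}_{\mathbb{Q}}(H)$, is the smallest $d'$ such that $H$ embeds into $\mathbb{Q}^{d'}$. $\mathbb{Z}\ltimes_A H$ is the semidirect product in which the generator $a$ of $\mathbb{Z}$ acts on $H$ by $a\,b\,a^{-1}=A(b)$, $b\in H$. A global fixed point of a group is a point fixed by all its elements. The action of $G$ is semiconjugate to that of an affine group if there exist a homomorphism $\psi:G\to\mathrm{Aff}_+(\mathbb{R})$ and a continuous, non-decreasing, surjective map $F:(0,1)\to\mathbb{R}$ with $F(g(x))=\psi(g)(F(x))$ for all $g\in G$, $x\in(0,1)$; here $\mathrm{Aff}_+(\mathbb{R})$ is the group of maps $x\mapsto\lambda x+t$ with $\lambda>0$, $t\in\mathbb{R}$. *)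

theory Defs
  imports
    "HOL-Analysis.Elementary_Topology"
    "HOL-Algebra.Group_Action"
    "Jordan_Normal_Form.Char_Poly"
begin

definition GLQ :: "nat \<Rightarrow> rat mat monoid" where
  "GLQ d = units_of (ring_mat TYPE(rat) d ())"

text \<open>The least dimension \<open>d'\<close> of a rational vector space that contains an isomorphic copy of the
  group \<open>H\<close>; meaningful whenever \<open>H\<close> embeds into some rational vector space of finite dimension,
  as every subgroup of one does.\<close>
definition rank_Q :: "('a, 'b) monoid_scheme \<Rightarrow> nat" where
  "rank_Q H = (LEAST d'. mon H (monoid_vec TYPE(rat) d') \<noteq> {})"

text \<open>The pair \<open>(m, u)\<close> stands for the product of the vector \<open>u\<close> (on the left) with the \<open>m\<close>-th
  power of the generator \<open>a = (1, 0)\<close>.  The exponent in the multiplication is an integer power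
  in the group \<open>GLQ d\<close>, hence for negative \<open>m\<close> a power of the inverse matrix.\<close>
definition Z_semidirect :: "nat \<Rightarrow> rat mat \<Rightarrow> rat vec set \<Rightarrow> (int \<times> rat vec) monoid" where
  "Z_semidirect d A H = \<lparr>
     carrier = UNIV \<times> H,
     monoid.mult = (\<lambda>(m, u) (n, v). (m + n, u + (A [^]\<^bsub>GLQ d\<^esub> m) *\<^sub>v v)),
     one = (0, 0\<^sub>v d)\<rparr>"

definition gen_a :: "nat \<Rightarrow> int \<times> rat vec" where
  "gen_a d = (1, 0\<^sub>v d)"

definition emb_H :: "rat vec \<Rightarrow> int \<times> rat vec" where
  "emb_H b = (0, b)"

definition Aff_plus :: "(real \<Rightarrow> real) monoid" where
  "Aff_plus = \<lparr>
     carrier = {f. \<exists>l t. l > 0 \<and> f = (\<lambda>x. l * x + t)},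
     monoid.mult = (\<circ>),
     one = id\<rparr>"

definition orient_pres_homeo :: "(real \<Rightarrow> real) \<Rightarrow> bool" where
  "orient_pres_homeo f \<longleftrightarrow>
     (\<exists>g. homeomorphism {0..1} {0..1} f g) \<and> strict_mono_on {0..1} f"

text \<open>\<open>group_action\<close> uses the extensional functions of \<open>BijGroup\<close>: only the values of \<open>\<phi> g\<close> on
  the closed unit interval are significant.\<close>
definition acts_on_interval :: "('g, 'm) monoid_scheme \<Rightarrow> ('g \<Rightarrow> real \<Rightarrow> real) \<Rightarrow> bool" where
  "acts_on_interval G \<phi> \<longleftrightarrow>
     group_action G {0..1} \<phi> \<and> (\<forall>g\<in>carrier G. orient_pres_homeo (\<phi> g))"

definition has_global_fixed_point :: "('g \<Rightarrow> real \<Rightarrow> real) \<Rightarrow> 'g set \<Rightarrow> bool" where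
  "has_global_fixed_point \<phi> S \<longleftrightarrow> (\<exists>x\<in>{0<..<1}. \<forall>g\<in>S. \<phi> g x = x)"

definition semiconjugate_to_affine ::
    "('g, 'm) monoid_scheme \<Rightarrow> ('g \<Rightarrow> real \<Rightarrow> real) \<Rightarrow> bool" where
  "semiconjugate_to_affine G \<phi> \<longleftrightarrow>
     (\<exists>\<psi>\<in>hom G Aff_plus. \<exists>F :: real \<Rightarrow> real.
        continuous_on {0<..<1} F \<and> mono_on {0<..<1} F \<and> F ` {0<..<1} = UNIV \<and>
        (\<forall>g\<in>carrier G. \<forall>x\<in>{0<..<1}. F (\<phi> g x) = \<psi> g (F x)))"

end

theory Submission
  imports Defs "HOL-Analysis.Elementary_Metric_Spaces" "HOL-Algebra.Generated_Groups"
begin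

text \<open>Conjugate \<open>(0, 1)\<close> to the line.  A closed invariant set of a homeomorphism with a fixed point
  contains a fixed point: if \<open>H\<close> has a global fixed point, apply this to \<open>a\<close> and the fixed point set
  of \<open>H\<close>.  Otherwise, since \<open>H\<close> has finite rank and commuting homeomorphisms with fixed points have
  a common one, some \<open>b \<in> H\<close> has no fixed point.  The elements of \<open>H\<close> moving every point
  to the right form an Archimedean cone, so by Hoelder's theorem they are the positive elements of
  a homomorphism \<open>\<tau> : H \<rightarrow> \<real>\<close>, unique up to scaling; hence \<open>\<tau> \<circ> A = l \<tau>\<close> with \<open>l > 0\<close>.  If \<open>l = 1\<close>
  then \<open>\<tau>\<close>, which is the restriction of a linear form, would give an eigenvalue 1 of \<open>A\<close>.  So
  \<open>l \<noteq> 1\<close>, the image of \<open>\<tau>\<close> is dense, and \<open>F x = sup {\<tau> h | h 0 \<le> x}\<close> is a continuous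
  semiconjugacy of \<open>H\<close> to translations.  It is unique up to a constant, so \<open>a\<close> acts through it
  as an affine map of slope \<open>l\<close>.\<close>

section \<open>Group actions on the real line\<close>

locale line_action = group +
  fixes \<alpha> :: "'a \<Rightarrow> real \<Rightarrow> real"
  assumes act_strict_mono: "g \<in> carrier G \<Longrightarrow> strict_mono (\<alpha> g)"
    and act_mult: "\<lbrakk>g \<in> carrier G; h \<in> carrier G\<rbrakk> \<Longrightarrow> \<alpha> (g \<otimes> h) x = \<alpha> g (\<alpha> h x)"
    and act_one [simp]: "\<alpha> \<one> x = x"
begin

lemma act_less_iff [simp]: "g \<in> carrier G \<Longrightarrow> \<alpha> g x < \<alpha> g y \<longleftrightarrow> x < y"
  by (simp add: act_strict_mono strict_mono_less)

lemma act_le_iff [simp]: "g \<in> carrier G \<Longrightarrow> \<alpha> g x \<le> \<alpha> g y \<longleftrightarrow> x \<le> y"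
  by (simp add: act_strict_mono strict_mono_less_eq)

lemma act_eq_iff [simp]: "g \<in> carrier G \<Longrightarrow> \<alpha> g x = \<alpha> g y \<longleftrightarrow> x = y"
  by (simp add: act_strict_mono strict_mono_eq)

lemma act_inv [simp]:
  assumes "g \<in> carrier G"
  shows "\<alpha> (inv g) (\<alpha> g x) = x" "\<alpha> g (\<alpha> (inv g) x) = x"
  using assms act_mult[of "inv g" g x] act_mult[of g "inv g" x] by simp_all

lemma act_inv_less_iff [simp]:
  assumes "g \<in> carrier G"
  shows "\<alpha> (inv g) x < y \<longleftrightarrow> x < \<alpha> g y" "x < \<alpha> (inv g) y \<longleftrightarrow> \<alpha> g x < y"
  using assms act_less_iff[of g "\<alpha> (inv g) x" y] act_less_iff[of g x "\<alpha> (inv g) y"]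
  by (simp_all del: act_less_iff)

lemma act_inv_eq_iff: "g \<in> carrier G \<Longrightarrow> \<alpha> (inv g) x = y \<longleftrightarrow> x = \<alpha> g y"
  by (metis act_inv)

lemma surj_act: "g \<in> carrier G \<Longrightarrow> surj (\<alpha> g)"
  by (metis act_inv(2) surjI)

text \<open>A monotone map of the line that is onto has no jumps.\<close>

lemma continuous_on_act: "g \<in> carrier G \<Longrightarrow> continuous_on S (\<alpha> g)"
  by (rule continuous_on_subset[OF continuous_onI_mono[of "\<alpha> g" UNIV]]) (auto simp: surj_act)

lemma closed_act_fixed: "g \<in> carrier G \<Longrightarrow> closed {x. \<alpha> g x = x}"
  by (intro closed_Collect_eq continuous_on_act continuous_on_id)

text \<open>The point of \<open>C\<close> nearest to a fixed point of \<open>g\<close> on one side of it is itself fixed.\<close>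
lemma fixed_point_in_invariant_set:
  assumes g: "g \<in> carrier G" and y: "\<alpha> g y = y"
    and C: "closed C" "C \<noteq> {}" and inv: "\<And>x. \<alpha> g x \<in> C \<longleftrightarrow> x \<in> C"
  shows "\<exists>z\<in>C. \<alpha> g z = z"
proof -
  obtain x where x: "x \<in> C" using C by auto
  have inv': "\<alpha> (inv g) z \<in> C" if "z \<in> C" for z using inv[of "\<alpha> (inv g) z"] g that by simp
  have y': "\<alpha> (inv g) y = y" using g y by (simp add: act_inv_eq_iff)
  have ig: "inv g \<in> carrier G" using g by simp
  show ?thesis
  proof (cases "x \<le> y")
    case True
    define S where "S = C \<inter> {..y}"
    have S: "closed S" "bdd_above S" "S \<noteq> {}"
      using C x True by (auto simp: S_def bdd_above_def)
    define z where "z = Sup S"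
    have z: "z \<in> C" "z \<le> y" using closed_contains_Sup[OF S(3,2,1)] by (auto simp: z_def S_def)
    \<comment> \<open>Both \<open>g\<close> and \<open>inv g\<close> map \<open>S\<close> into
      itself, because they fix \<open>y\<close>; hence its supremum \<open>z\<close> can move in
      neither direction.\<close>
    have "\<alpha> g z \<in> S" using z inv act_le_iff[OF g, of z y] y by (simp add: S_def)
    then have 1: "\<alpha> g z \<le> z" unfolding z_def by (intro cSup_upper S)
    have "\<alpha> (inv g) z \<in> S" using z inv' act_le_iff[OF ig, of z y] y' by (simp add: S_def)
    then have "\<alpha> (inv g) z \<le> z" unfolding z_def by (intro cSup_upper S)
    then have "z \<le> \<alpha> g z" using act_le_iff[OF g, of "\<alpha> (inv g) z" z] g by (simp del: act_le_iff)
    with 1 z show ?thesis by (intro bexI[of _ z]) auto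
  next
    case False
    define S where "S = C \<inter> {y..}"
    have S: "closed S" "bdd_below S" "S \<noteq> {}"
      using C x False by (auto simp: S_def bdd_below_def)
    define z where "z = Inf S"
    have z: "z \<in> C" "z \<ge> y" using closed_contains_Inf[OF S(3,2,1)] by (auto simp: z_def S_def)
    have "\<alpha> g z \<in> S" using z inv act_le_iff[OF g, of y z] y by (simp add: S_def)
    then have 1: "\<alpha> g z \<ge> z" unfolding z_def by (intro cInf_lower S)
    have "\<alpha> (inv g) z \<in> S" using z inv' act_le_iff[OF ig, of y z] y' by (simp add: S_def)
    then have "\<alpha> (inv g) z \<ge> z" unfolding z_def by (intro cInf_lower S)
    then have "z \<ge> \<alpha> g z" using act_le_iff[OF g, of z "\<alpha> (inv g) z"] g by (simp del: act_le_iff)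
    with 1 z show ?thesis by (intro bexI[of _ z]) auto
  qed
qed

lemma act_nat_pow_greater:
  assumes g: "g \<in> carrier G" and "\<alpha> g x > x" "n > 0"
  shows "\<alpha> (g [^] (n::nat)) x > x"
  using assms(3)
proof (induction n)
  case (Suc n)
  have "\<alpha> (g [^] n) x < \<alpha> (g [^] n) (\<alpha> g x)" using assms by simp
  then have "\<alpha> (g [^] n) x < \<alpha> (g [^] Suc n) x" using g by (simp add: act_mult)
  then show ?case using Suc by (cases "n = 0") (use g assms in auto)
qed simp

lemma act_nat_pow_fixed:
  assumes "g \<in> carrier G" "\<alpha> g x = x"
  shows "\<alpha> (g [^] (n::nat)) x = x"
  by (induction n) (use assms in \<open>auto simp: act_mult\<close>)

lemma act_int_pow_fixed:
  assumes "g \<in> carrier G" "\<alpha> g x = x"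
  shows "\<alpha> (g [^] (n::int)) x = x"
  by (cases n rule: int_cases2) (use assms act_nat_pow_fixed[OF assms] in
      \<open>simp_all add: int_pow_int int_pow_neg_int act_inv_eq_iff\<close>)

text \<open>A point that is not fixed is moved to the right by \<open>g\<close> or by
  \<open>inv g\<close>; positive powers of that element still move it to the right, so it never
  returns.\<close>

lemma act_int_pow_fixed_iff:
  assumes g: "g \<in> carrier G" and "n > 0"
  shows "\<alpha> (g [^] (n::int)) x = x \<longleftrightarrow> \<alpha> g x = x"
proof
  assume eq: "\<alpha> (g [^] n) x = x"
  define m where "m = nat n"
  have m: "g [^] n = g [^] m" "m > 0" using assms int_pow_int[of G g "nat n"] by (simp_all add: m_def)
  show "\<alpha> g x = x"
  proof (rule ccontr)
    assume "\<alpha> g x \<noteq> x"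
    then consider "\<alpha> g x > x" | "\<alpha> (inv g) x > x" using g by fastforce
    then show False
    proof cases
      case 1
      then show ?thesis using act_nat_pow_greater[OF g 1 m(2)] eq m by simp
    next
      case 2
      have "\<alpha> (inv g [^] m) x > x" using act_nat_pow_greater[OF _ 2 m(2)] g by simp
      then have "\<alpha> (inv (g [^] m)) x > x" using g by (simp add: nat_pow_inv)
      then show ?thesis using eq m g by simp
    qed
  qed
qed (simp add: act_int_pow_fixed g)

text \<open>Intermediate value theorem for the displacement \<open>\<alpha> g x - x\<close>.\<close>

lemma no_fixed_point_cases:
  assumes g: "g \<in> carrier G" and "\<forall>x. \<alpha> g x \<noteq> x"
  shows "(\<forall>x. \<alpha> g x > x) \<or> (\<forall>x. \<alpha> g x < x)"
proof (rule ccontr)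
  assume "\<not> ?thesis"
  then obtain x y where xy: "\<alpha> g x < x" "\<alpha> g y > y"
    using assms by (metis linorder_less_linear)
  have cont: "continuous_on S (\<lambda>x. \<alpha> g x - x)" for S
    by (intro continuous_intros continuous_on_act g)
  have "\<exists>z. \<alpha> g z - z = 0"
  proof (cases "x \<le> y")
    case True
    then show ?thesis using IVT'[of "\<lambda>x. \<alpha> g x - x" x 0 y] cont xy by fastforce
  next
    case False
    then show ?thesis using IVT2'[of "\<lambda>x. \<alpha> g x - x" x 0 y] cont xy by fastforce
  qed
  then show False using assms by auto
qed

text \<open>\<open>inv g\<close> would move the supremum of a bounded orbit below some orbit point,
  whose image under \<open>g\<close> would then exceed the supremum.\<close>

lemma orbit_unbounded:
  assumes g: "g \<in> carrier G" and up: "\<forall>x. \<alpha> g x > x"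
  shows "\<exists>n::nat. \<alpha> (g [^] n) x > y"
proof (rule ccontr)
  assume "\<not> ?thesis"
  then have b: "\<alpha> (g [^] n) x \<le> y" for n :: nat by (meson not_less)
  define S where "S = range (\<lambda>n::nat. \<alpha> (g [^] n) x)"
  have S: "S \<noteq> {}" "bdd_above S" using b by (auto simp: S_def bdd_above_def)
  have "\<alpha> (inv g) (Sup S) < Sup S" using up g by simp
  then obtain n :: nat where "\<alpha> (inv g) (Sup S) < \<alpha> (g [^] n) x"
    using less_cSup_iff[OF S] by (auto simp: S_def)
  then have "Sup S < \<alpha> g (\<alpha> (g [^] n) x)" using g by simp
  also have "\<dots> = \<alpha> (g [^] Suc n) x"
    using g by (simp add: act_mult[symmetric] nat_pow_Suc2[symmetric] del: nat_pow_Suc)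
  also have "\<dots> \<le> Sup S" by (rule cSup_upper[OF _ S(2)]) (auto simp only: S_def)
  finally show False by simp
qed

text \<open>The positive cone to which Hoelder's theorem will be applied; elements with a fixed
  point will count as zero.\<close>

definition up_elems :: "'a set" where
  "up_elems = {g \<in> carrier G. \<forall>x. \<alpha> g x > x}"

lemma up_elems_subset: "up_elems \<subseteq> carrier G"
  by (auto simp: up_elems_def)

lemma mult_up_elems: "g \<in> up_elems \<Longrightarrow> h \<in> up_elems \<Longrightarrow> g \<otimes> h \<in> up_elems"
  unfolding up_elems_def by (auto simp: act_mult intro: less_trans[of _ "\<alpha> h _"])

lemma fixed_point_if_not_up:
  assumes "g \<in> carrier G" "g \<notin> up_elems" "inv g \<notin> up_elems"
  shows "\<exists>x. \<alpha> g x = x"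
  using no_fixed_point_cases[OF assms(1)] assms by (auto simp: up_elems_def)

end

section \<open>Commuting homeomorphisms of the line\<close>

locale comm_line_action = line_action + comm_group
begin

lemma act_commute: "g \<in> carrier G \<Longrightarrow> h \<in> carrier G \<Longrightarrow> \<alpha> g (\<alpha> h x) = \<alpha> h (\<alpha> g x)"
  by (metis act_mult m_comm)

text \<open>By commutativity \<open>g\<close> preserves the closed set of common fixed points of
  \<open>S\<close>, so \<open>fixed_point_in_invariant_set\<close> applies.\<close>

lemma common_fixed_point:
  assumes g: "g \<in> carrier G" "\<alpha> g y = y" and S: "S \<subseteq> carrier G" "\<forall>s\<in>S. \<alpha> s x = x"
  shows "\<exists>z. \<alpha> g z = z \<and> (\<forall>s\<in>S. \<alpha> s z = z)"
proof -
  define C where "C = (\<Inter>s\<in>S. {x. \<alpha> s x = x})"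
  have "closed C" using S by (auto simp: C_def intro!: closed_act_fixed)
  moreover have "C \<noteq> {}" using S by (auto simp: C_def)
  moreover have "\<alpha> g u \<in> C \<longleftrightarrow> u \<in> C" for u
  proof -
    have "\<alpha> s (\<alpha> g u) = \<alpha> g u \<longleftrightarrow> \<alpha> s u = u" if "s \<in> S" for s
      using act_commute[of s g u] g S that by auto
    then show ?thesis by (simp add: C_def)
  qed
  ultimately show ?thesis using fixed_point_in_invariant_set[OF g, of C] by (auto simp: C_def)
qed

text \<open>At \<open>x\<close> the product moves to the right as \<open>g\<close> does, so it could
  miss the cone only by having a fixed point. It would then share one with \<open>h\<close>, and
  \<open>g\<close> would fix that point too.\<close>

lemma mult_up_elems_fixed:
  assumes g: "g \<in> up_elems" and h: "h \<in> carrier G" "\<alpha> h x = x"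
  shows "h \<otimes> g \<in> up_elems"
proof (rule ccontr)
  have G: "g \<in> carrier G" "\<And>x. \<alpha> g x > x" using g by (auto simp: up_elems_def)
  assume "h \<otimes> g \<notin> up_elems"
  moreover have "inv (h \<otimes> g) \<notin> up_elems"
  proof
    assume "inv (h \<otimes> g) \<in> up_elems"
    then have "\<alpha> (g \<otimes> h) x < x" using G(1) h by (simp add: up_elems_def m_comm)
    then have "\<alpha> g x < x" using act_mult[of g h x] G(1) h by simp
    then show False using G(2)[of x] by simp
  qed
  ultimately obtain y where "\<alpha> (h \<otimes> g) y = y"
    using fixed_point_if_not_up[of "h \<otimes> g"] G(1) h by auto
  then obtain z where "\<alpha> (h \<otimes> g) z = z" "\<alpha> h z = z"
    using common_fixed_point[of "h \<otimes> g" y "{h}" x] G(1) h by auto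
  then have "\<alpha> h (\<alpha> g z) = \<alpha> h z" using G(1) h by (simp add: act_mult)
  then show False using G(2)[of z] G(1) h by simp
qed

text \<open>A power of \<open>g\<close> large enough to make
  \<open>e = g [^] n \<otimes> inv h\<close> move the single point \<open>0\<close> to the right
  suffices: then \<open>e\<close> is in the cone or has a fixed point, and in both cases one more
  factor \<open>g\<close> leads into the cone.\<close>

lemma up_elems_archimedean:
  assumes g: "g \<in> up_elems" and h: "h \<in> carrier G"
  shows "\<exists>n::nat. g [^] n \<otimes> inv h \<in> up_elems"
proof -
  have G: "g \<in> carrier G" "\<forall>x. \<alpha> g x > x" using g by (auto simp: up_elems_def)
  obtain n :: nat where n: "\<alpha> (g [^] n) (\<alpha> (inv h) 0) > 0"
    using orbit_unbounded[OF G] by blast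
  define e where "e = g [^] n \<otimes> inv h"
  have e: "e \<in> carrier G" "inv e \<notin> up_elems"
    using n G h by (auto simp: e_def up_elems_def act_mult not_less intro!: exI[of _ 0] less_imp_le)
  have "e \<otimes> g \<in> up_elems"
    using mult_up_elems[of e g] mult_up_elems_fixed[OF g e(1)] fixed_point_if_not_up[OF e(1)] e g
    by blast
  also have "e \<otimes> g = g [^] Suc n \<otimes> inv h" using G h by (simp add: e_def m_ac)
  finally show ?thesis by blast
qed

end

section \<open>Hoelder's theorem\<close>

lemma fraction_between:
  assumes "x < (y::real)"
  obtains p q :: int where "q > 0" "x < of_int p / of_int q" "of_int p / of_int q < y"
proof -
  obtain r where r: "x < of_rat r" "of_rat r < y" using of_rat_dense[OF assms] by blast
  obtain p q where pq: "quotient_of r = (p, q)" by force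
  have "of_rat r = (of_int p / of_int q :: real)"
    using quotient_of_div[OF pq] by (simp add: of_rat_divide)
  then show thesis using that[of q p] r quotient_of_denom_pos[OF pq] by simp
qed

text \<open>\<open>P\<close> is the cone of a preorder rather than of an order: elements with
  neither themselves nor their inverse in \<open>P\<close> count as zero, and \<open>absorb\<close>
  says that they do not affect positivity. The value \<open>\<tau> x\<close> is the supremum of the
  fractions \<open>p / q\<close> such that \<open>x [^] q\<close> exceeds
  \<open>b [^] p\<close>.\<close>

lemma (in comm_group) hoelder:
  fixes P :: "'a set"
  assumes sub: "P \<subseteq> carrier G" and mult: "\<And>x y. x \<in> P \<Longrightarrow> y \<in> P \<Longrightarrow> x \<otimes> y \<in> P"
    and one: "\<one> \<notin> P"
    and absorb: "\<And>x y. \<lbrakk>x \<in> carrier G; x \<notin> P; inv x \<notin> P; y \<in> P\<rbrakk> \<Longrightarrow> x \<otimes> y \<in> P"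
    and arch: "\<And>x y. \<lbrakk>x \<in> P; y \<in> carrier G\<rbrakk> \<Longrightarrow> \<exists>n::nat. x [^] n \<otimes> inv y \<in> P"
    and b: "b \<in> P"
  obtains \<tau> :: "'a \<Rightarrow> real"
  where "\<And>x y. \<lbrakk>x \<in> carrier G; y \<in> carrier G\<rbrakk> \<Longrightarrow> \<tau> (x \<otimes> y) = \<tau> x + \<tau> y"
    and "\<tau> b = 1" and "\<And>x. x \<in> carrier G \<Longrightarrow> \<tau> x > 0 \<longleftrightarrow> x \<in> P"
proof -
  have bG [simp]: "b \<in> carrier G" using b sub by auto
  have asym: "inv x \<notin> P" if "x \<in> P" for x
    using mult[OF that, of "inv x"] that sub one by auto
  have pow: "x [^] n \<in> P" if "x \<in> P" "n > 0" for x and n :: nat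
    using that(2)
  proof (induction n)
    case (Suc n)
    then show ?case using that(1) sub mult by (cases "n = 0") auto
  qed simp
  have ipow: "x [^] n \<in> P" if "x \<in> P" "n > 0" for x and n :: int
    using pow[OF that(1), of "nat n"] that(2) int_pow_int[of G x "nat n"] by simp
  have root: "x \<in> P" if x: "x \<in> carrier G" "x [^] n \<in> P" for x and n :: nat
  proof (rule ccontr)
    assume xP: "x \<notin> P"
    have "n > 0" using x one by (cases n) auto
    show False
    proof (cases "inv x \<in> P")
      case True
      then have "inv (x [^] n) \<in> P" using pow[OF True \<open>n > 0\<close>] x by (simp add: nat_pow_inv)
      then show ?thesis using asym x by blast
    next
      case False
      \<comment> \<open>Here \<open>x\<close> and \<open>inv x\<close> count as zero, so multiplying
        a power of \<open>x\<close> in \<open>P\<close> by \<open>inv x\<close> would stay in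
        \<open>P\<close> and lead down to \<open>\<one>\<close>.\<close>
      have "x [^] m \<notin> P" for m :: nat
      proof (induction m)
        case (Suc m)
        have "inv x \<otimes> (x [^] Suc m) = x [^] m" using x by (simp add: m_ac l_inv[symmetric])
            (metis inv_closed l_inv m_comm m_lcomm nat_pow_closed r_one)
        then show ?case using absorb[of "inv x" "x [^] Suc m"] x xP False Suc by auto
      qed (simp add: one)
      then show ?thesis using x by blast
    qed
  qed
  have iroot: "x \<in> P" if "x \<in> carrier G" "x [^] n \<in> P" "n > 0" for x and n :: int
    using root[of x "nat n"] that int_pow_int[of G x "nat n"] by simp

  text \<open>\<open>e x q p \<in> P\<close> expresses that \<open>p / q\<close> is a lower bound for the size of \<open>x\<close> relative to \<open>b\<close>.\<close>
  define e where "e x q p = x [^] q \<otimes> b [^] (- p)" for x and q p :: int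
  have eG [simp]: "e x q p \<in> carrier G" if "x \<in> carrier G" for x q p
    using that by (simp add: e_def)
  have e_pow: "e x q p [^] n = e x (q * n) (p * n)" if "x \<in> carrier G" for x q p and n :: int
    using that by (simp add: e_def int_pow_distrib int_pow_pow)
  have e_mult: "e x q p \<otimes> e y q p' = e (x \<otimes> y) q (p + p')"
    if "x \<in> carrier G" "y \<in> carrier G" for x y q p p'
  proof -
    have "b [^] (- (p + p')) = b [^] (- p) \<otimes> b [^] (- p')"
      using int_pow_mult[of b "-p" "-p'"] by simp
    then show ?thesis using that by (simp add: e_def int_pow_distrib m_ac)
  qed
  have e_inv: "inv (e x q p) = e (inv x) q (- p)" if "x \<in> carrier G" for x q p
    using that by (simp add: e_def inv_mult int_pow_inv[symmetric] int_pow_neg)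
  have e_b: "e x q p' = e x q p \<otimes> b [^] (p - p')" if "x \<in> carrier G" for x q p p'
  proof -
    have "b [^] (- p') = b [^] (- p) \<otimes> b [^] (p - p')"
      using int_pow_mult[of b "-p" "p - p'"] by simp
    then show ?thesis using that by (simp add: e_def m_assoc)
  qed
  \<comment> \<open>Lower bounds are closed downwards: the powers \<open>q\<close> and
    \<open>q'\<close> bring both fractions to the denominator \<open>q * q'\<close>, the difference
    is a nonnegative power of \<open>b\<close>, and \<open>iroot\<close> removes the exponent
    again.\<close>
  have down: "e x q' p' \<in> P"
    if "x \<in> carrier G" "e x q p \<in> P" "q > 0" "q' > 0" "p' * q \<le> p * q'" for x q p q' p'
  proof -
    have "e x q' p' [^] q = e x q p [^] q' \<otimes> b [^] (p * q' - p' * q)"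
      using that e_b[of x "q * q'" "p' * q" "p * q'"] by (simp add: e_pow mult.commute)
    moreover have "e x q p [^] q' \<in> P" using that ipow by blast
    moreover have "b [^] (p * q' - p' * q) \<in> P" if "p' * q < p * q'"
      using that ipow[OF b] by simp
    ultimately have "e x q' p' [^] q \<in> P"
      using mult that sub by (cases "p' * q = p * q'") auto
    then show ?thesis using iroot that eG by blast
  qed
  \<comment> \<open>Strictly above a fraction that is no lower bound, \<open>x\<close> is strictly
    smaller: if \<open>e x q' p'\<close> counted as zero, then by \<open>absorb\<close> the positive
    power of \<open>b\<close> filling the gap would force \<open>e x q p\<close> into
    \<open>P\<close>.\<close>
  have strict_up: "inv (e x q' p') \<in> P"
    if "x \<in> carrier G" "e x q p \<notin> P" "q > 0" "q' > 0" "p * q' < p' * q" for x q p q' p'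
  proof (rule ccontr)
    assume n: "inv (e x q' p') \<notin> P"
    have "e x q' p' \<notin> P" using down[of x q' p' q p] that by auto
    moreover have "inv (e x q' p') [^] q = inv (e x q' p' [^] q)"
      using that by (simp add: int_pow_inv)
    ultimately have "e x q' p' [^] q \<notin> P" "inv (e x q' p' [^] q) \<notin> P"
      using n iroot[of "e x q' p'" q] iroot[of "inv (e x q' p')" q] that by auto
    moreover have "b [^] (p' * q - p * q') \<in> P" using that ipow[OF b] by simp
    ultimately have "e x q' p' [^] q \<otimes> b [^] (p' * q - p * q') \<in> P"
      using absorb that by simp
    also have "e x q' p' [^] q \<otimes> b [^] (p' * q - p * q') = e x q p [^] q'"
      using that e_b[of x "q * q'" "p * q'" "p' * q"] by (simp add: e_pow mult.commute)
    finally show False using iroot[of "e x q p" q'] that by simp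
  qed

  define S :: "'a \<Rightarrow> real set" where "S x = {of_int p / of_int q | p q. q > 0 \<and> e x q p \<in> P}" for x
  have ineq: "p' * q \<le> p * q'"
    if "of_int p' / of_int q' \<le> (of_int p / of_int q :: real)" "q > 0" "q' > 0" for p q p' q' :: int
    using that by (simp add: field_simps flip: of_int_mult)
  have S_ne: "S x \<noteq> {}" if "x \<in> carrier G" for x
  proof -
    obtain n :: nat where "b [^] n \<otimes> inv (inv x) \<in> P" using arch[OF b, of "inv x"] \<open>x \<in> carrier G\<close> by auto
    then have "e x 1 (- int n) \<in> P" using that by (simp add: e_def int_pow_int m_comm)
    then have "of_int (- int n) / of_int 1 \<in> S x"
      unfolding S_def by (intro CollectI exI[of _ "- int n"] exI[of _ 1]) simp
    then show ?thesis by blast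
  qed
  have S_bdd: "bdd_above (S x)" if x: "x \<in> carrier G" for x
  proof -
    obtain n :: nat where "b [^] n \<otimes> inv x \<in> P" using arch[OF b x] by auto
    then have "inv (e x 1 (int n)) \<in> P"
      using x by (simp add: e_inv) (simp add: e_def int_pow_int m_comm)
    then have n: "e x 1 (int n) \<notin> P" using asym by blast
    have "r \<le> real n" if r: "r \<in> S x" for r
    proof (rule ccontr)
      assume "\<not> r \<le> real n"
      moreover obtain p q where pq: "r = of_int p / of_int q" "q > 0" "e x q p \<in> P"
        using r by (auto simp: S_def)
      ultimately have "int n * q \<le> p * 1" by (intro ineq) auto
      then show False using down[OF x pq(3,2), of 1 "int n"] n by simp
    qed
    then show ?thesis by (auto simp: bdd_above_def)
  qed
  define \<tau> where "\<tau> x = Sup (S x)" for x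
  have below: "e x q p \<in> P" if x: "x \<in> carrier G" and pq: "of_int p / of_int q < \<tau> x" "q > 0" for x p q
  proof -
    obtain r where r: "r \<in> S x" "of_int p / of_int q < r"
      using pq less_cSup_iff[OF S_ne[OF x] S_bdd[OF x]] by (auto simp: \<tau>_def)
    then obtain p' q' where pq': "r = of_int p' / of_int q'" "q' > 0" "e x q' p' \<in> P"
      by (auto simp: S_def)
    then have "p * q' \<le> p' * q" using r pq by (intro ineq) auto
    then show ?thesis using down[OF x pq'(3,2)] pq by simp
  qed
  have le_tau: "of_int p / of_int q \<le> \<tau> x" if "x \<in> carrier G" "e x q p \<in> P" "q > 0" for x p q
    unfolding \<tau>_def by (intro cSup_upper S_bdd) (use that in \<open>auto simp: S_def\<close>)
  have super: "\<tau> x + \<tau> y \<le> \<tau> (x \<otimes> y)" if x: "x \<in> carrier G" and y: "y \<in> carrier G" for x y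
  proof (rule ccontr)
    assume "\<not> ?thesis"
    \<comment> \<open>The supposed defect is split evenly: fractions within half of it below
      \<open>\<tau> x\<close> and \<open>\<tau> y\<close> add up to a lower bound for
      \<open>x \<otimes> y\<close> that exceeds \<open>\<tau> (x \<otimes> y)\<close>.\<close>
    then have d: "\<tau> x - (\<tau> x + \<tau> y - \<tau> (x \<otimes> y)) / 2 < \<tau> x"
      "\<tau> y - (\<tau> x + \<tau> y - \<tau> (x \<otimes> y)) / 2 < \<tau> y" by auto
    obtain p q :: int where pq: "q > 0" "\<tau> x - (\<tau> x + \<tau> y - \<tau> (x \<otimes> y)) / 2 < of_int p / of_int q"
      "of_int p / of_int q < \<tau> x"
      using d(1) by (rule fraction_between)
    obtain p' q' :: int where pq': "q' > 0" "\<tau> y - (\<tau> x + \<tau> y - \<tau> (x \<otimes> y)) / 2 < of_int p' / of_int q'"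
      "of_int p' / of_int q' < \<tau> y"
      using d(2) by (rule fraction_between)
    have "e x q p [^] q' \<otimes> e y q' p' [^] q \<in> P"
      using below pq pq' x y by (intro mult ipow) auto
    then have "e (x \<otimes> y) (q * q') (p * q' + p' * q) \<in> P"
      using x y by (simp add: e_pow mult.commute[of q' q] e_mult)
    then have le: "of_int (p * q' + p' * q) / of_int (q * q') \<le> \<tau> (x \<otimes> y)"
      using x y pq pq' by (intro le_tau) auto
    have eq: "of_int (p * q' + p' * q) / of_int (q * q') = (of_int p / of_int q + of_int p' / of_int q' :: real)"
      using pq pq' by (simp add: field_simps)
    have False if "r + s \<le> t" "a - (a + b - t) / 2 < r" "b - (a + b - t) / 2 < s" for r s t a b :: real
      using that by (simp add: field_simps)
    then show False using le[unfolded eq] pq(2) pq'(2) by blast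
  qed
  have inv_ge: "- \<tau> x \<le> \<tau> (inv x)" if x: "x \<in> carrier G" for x
  proof (rule ccontr)
    assume "\<not> ?thesis"
    then have "\<tau> x < - \<tau> (inv x)" by simp
    then obtain p q :: int where pq: "q > 0" "\<tau> x < of_int p / of_int q" "of_int p / of_int q < - \<tau> (inv x)"
      by (rule fraction_between)
    \<comment> \<open>The second, smaller fraction is already no lower bound for \<open>x\<close>;
      it supplies the strict gap that \<open>strict_up\<close> requires.\<close>
    then obtain p' q' :: int where pq': "q' > 0" "\<tau> x < of_int p' / of_int q'"
      "of_int p' / of_int q' < (of_int p / of_int q :: real)"
      using fraction_between by blast
    have "e x q' p' \<notin> P" using le_tau[OF x _ pq'(1), of p'] pq' by auto
    moreover have "p' * q < p * q'" using pq(1) pq'(1,3) by (simp add: field_simps flip: of_int_mult)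
    ultimately have "inv (e x q p) \<in> P" using strict_up[OF x] pq pq' by blast
    then have "of_int (- p) / of_int q \<le> \<tau> (inv x)" using x pq by (intro le_tau) (auto simp: e_inv)
    then show False using pq by simp
  qed
  have "\<tau> \<one> \<le> 0"
  proof -
    have "\<tau> \<one> + \<tau> \<one> \<le> \<tau> \<one>" using super[of \<one> \<one>] by simp
    then show ?thesis by simp
  qed
  then have inv: "\<tau> (inv x) = - \<tau> x" if "x \<in> carrier G" for x
    using super[of x "inv x"] inv_ge[of x] that by simp
  \<comment> \<open>The reverse inequality is superadditivity for \<open>x \<otimes> y\<close> and
    \<open>inv y\<close>.\<close>
  have add: "\<tau> (x \<otimes> y) = \<tau> x + \<tau> y" if "x \<in> carrier G" "y \<in> carrier G" for x y
    using super[of x y] super[of "x \<otimes> y" "inv y"] that by (simp add: inv m_assoc)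
  have "\<tau> b \<ge> 1"
  proof (rule ccontr)
    assume "\<not> ?thesis"
    then have "\<tau> b < 1" by simp
    then obtain p q :: int where pq: "q > 0" "\<tau> b < of_int p / of_int q" "of_int p / of_int q < (1::real)"
      by (rule fraction_between)
    then have "e b q p = b [^] (q - p)" by (simp add: e_def int_pow_diff int_pow_neg)
    moreover have "p < q" using pq by simp
    ultimately have "e b q p \<in> P" using ipow[OF b] by simp
    then show False using le_tau[OF bG _ pq(1), of p] pq by simp
  qed
  moreover have "\<tau> b \<le> 1"
  proof (rule ccontr)
    assume "\<not> ?thesis"
    then have "e b 1 1 \<in> P" by (intro below) auto
    moreover have "e b 1 1 = \<one>" by (simp add: e_def int_pow_neg)
    ultimately show False using one by simp
  qed
  moreover have "\<tau> x > 0 \<longleftrightarrow> x \<in> P" if x: "x \<in> carrier G" for x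
  proof
    assume "\<tau> x > 0"
    then have "e x 1 0 \<in> P" by (intro below x) auto
    then show "x \<in> P" using x by (simp add: e_def)
  next
    assume P: "x \<in> P"
    \<comment> \<open>Membership in \<open>P\<close> by itself gives only the lower bound
      \<open>0\<close>; comparison with \<open>b\<close> through \<open>arch\<close> improves it to
      \<open>1 / n\<close>.\<close>
    obtain n :: nat where n: "x [^] n \<otimes> inv b \<in> P" using arch[OF P bG] by auto
    then have "n > 0" using asym[OF b] by (cases n) auto
    have "e x (int n) 1 \<in> P" using n by (simp add: e_def int_pow_int int_pow_neg)
    then have "of_int 1 / of_int (int n) \<le> \<tau> x" using x \<open>n > 0\<close> by (intro le_tau) auto
    moreover have "of_int 1 / of_int (int n) > (0::real)" using \<open>n > 0\<close> by simp
    ultimately show "\<tau> x > 0" by linarith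
  qed
  ultimately show thesis using that[of \<tau>] add by force
qed

section \<open>Additive maps on a group and their uniqueness up to scale\<close>

context group
begin

lemma additive_one:
  fixes f :: "'a \<Rightarrow> 'f::ab_group_add"
  assumes "\<And>x y. \<lbrakk>x \<in> carrier G; y \<in> carrier G\<rbrakk> \<Longrightarrow> f (x \<otimes> y) = f x + f y"
  shows "f \<one> = 0"
  using assms[of \<one> \<one>] by simp

lemma additive_inv:
  fixes f :: "'a \<Rightarrow> 'f::ab_group_add"
  assumes "\<And>x y. \<lbrakk>x \<in> carrier G; y \<in> carrier G\<rbrakk> \<Longrightarrow> f (x \<otimes> y) = f x + f y"
    and "x \<in> carrier G"
  shows "f (inv x) = - f x"
proof -
  have "f (inv x) + f x = 0" using assms(1)[of "inv x" x] additive_one[of f] assms by simp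
  then show ?thesis by (simp add: eq_neg_iff_add_eq_0)
qed

lemma additive_int_pow:
  fixes f :: "'a \<Rightarrow> 'f::ring_1"
  assumes add: "\<And>x y. \<lbrakk>x \<in> carrier G; y \<in> carrier G\<rbrakk> \<Longrightarrow> f (x \<otimes> y) = f x + f y"
    and x: "x \<in> carrier G"
  shows "f (x [^] (n::int)) = of_int n * f x"
proof -
  have nat: "f (x [^] m) = of_nat m * f x" for m :: nat
    using additive_one[of f] by (induction m) (auto simp: add x algebra_simps)
  show ?thesis
    using additive_inv[of f] x
    by (cases n rule: int_cases2) (simp_all add: int_pow_int int_pow_neg_int nat add)
qed

end

text \<open>The two maps are compared through the elements \<open>x\<^sup>q b\<^sup>-\<^sup>p\<close>, on which they have the same sign.\<close>
lemma (in group) additive_eq_if_same_positives: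
  fixes \<sigma> \<tau> :: "'a \<Rightarrow> real"
  assumes sig: "\<And>x y. \<lbrakk>x \<in> carrier G; y \<in> carrier G\<rbrakk> \<Longrightarrow> \<sigma> (x \<otimes> y) = \<sigma> x + \<sigma> y"
    and tau: "\<And>x y. \<lbrakk>x \<in> carrier G; y \<in> carrier G\<rbrakk> \<Longrightarrow> \<tau> (x \<otimes> y) = \<tau> x + \<tau> y"
    and pos: "\<And>x. x \<in> carrier G \<Longrightarrow> \<sigma> x > 0 \<longleftrightarrow> \<tau> x > 0"
    and b: "b \<in> carrier G" "\<tau> b = 1" and x: "x \<in> carrier G"
  shows "\<sigma> x = \<sigma> b * \<tau> x"
proof -
  have sb: "\<sigma> b > 0" using pos b by simp
  have key: "of_int q * \<sigma> x - of_int p * \<sigma> b > 0 \<longleftrightarrow> of_int q * \<tau> x - of_int p > 0" for p q :: int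
    using pos[of "x [^] q \<otimes> b [^] (- p)"] b x
    by (simp add: sig tau additive_int_pow[of \<sigma>, OF sig] additive_int_pow[of \<tau>, OF tau])
  have "\<sigma> x / \<sigma> b = \<tau> x"
  proof (rule ccontr)
    assume "\<sigma> x / \<sigma> b \<noteq> \<tau> x"
    then consider "\<sigma> x / \<sigma> b < \<tau> x" | "\<tau> x < \<sigma> x / \<sigma> b" by linarith
    then show False
    proof cases
      case 1
      then obtain p q :: int where "q > 0" "\<sigma> x / \<sigma> b < of_int p / of_int q" "of_int p / of_int q < \<tau> x"
        by (rule fraction_between)
      then show False using key[of q p] sb by (simp add: field_simps)
    next
      case 2
      then obtain p q :: int where "q > 0" "\<tau> x < of_int p / of_int q" "of_int p / of_int q < \<sigma> x / \<sigma> b"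
        by (rule fraction_between)
      then show False using key[of q p] sb by (simp add: field_simps)
    qed
  qed
  then show ?thesis using sb by (simp add: field_simps)
qed

section \<open>Semiconjugacy to translations\<close>

text \<open>An element that counts as zero for the cone \<open>up_elems\<close> has a fixed point,
  so \<open>absorb\<close> is \<open>mult_up_elems_fixed\<close>.\<close>

lemma (in comm_line_action) translation_number_exists:
  assumes "b \<in> up_elems"
  obtains \<tau> :: "'a \<Rightarrow> real"
  where "\<And>x y. \<lbrakk>x \<in> carrier G; y \<in> carrier G\<rbrakk> \<Longrightarrow> \<tau> (x \<otimes> y) = \<tau> x + \<tau> y"
    and "\<tau> b = 1" and "\<And>x. x \<in> carrier G \<Longrightarrow> \<tau> x > 0 \<longleftrightarrow> x \<in> up_elems"
proof -
  have "x \<otimes> y \<in> up_elems"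
    if "x \<in> carrier G" "x \<notin> up_elems" "inv x \<notin> up_elems" "y \<in> up_elems" for x y
    using that fixed_point_if_not_up mult_up_elems_fixed by blast
  moreover have "\<one> \<notin> up_elems" by (simp add: up_elems_def)
  ultimately show thesis
    using hoelder[of up_elems b thesis] up_elems_subset mult_up_elems up_elems_archimedean assms that
    by presburger
qed

section \<open>The developing map of an action with dense translation numbers\<close>

locale dense_translation_number = comm_line_action +
  fixes \<tau> :: "'a \<Rightarrow> real"
  assumes tau_mult: "\<lbrakk>g \<in> carrier G; h \<in> carrier G\<rbrakk> \<Longrightarrow> \<tau> (g \<otimes> h) = \<tau> g + \<tau> h"
    and tau_pos_iff: "g \<in> carrier G \<Longrightarrow> \<tau> g > 0 \<longleftrightarrow> g \<in> up_elems"
    and tau_dense: "u < v \<Longrightarrow> \<exists>g\<in>carrier G. u < \<tau> g \<and> \<tau> g < v"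
begin

lemma tau_inv: "g \<in> carrier G \<Longrightarrow> \<tau> (inv g) = - \<tau> g"
  by (rule additive_inv[of \<tau>, OF tau_mult])

text \<open>Comparison at one point is enough: if \<open>\<tau> g\<close> were larger,
  \<open>g \<otimes> inv h\<close> would move every point to the right, in particular
  \<open>\<alpha> h x\<close>.\<close>

lemma tau_le:
  assumes "g \<in> carrier G" "h \<in> carrier G" "\<alpha> g x \<le> \<alpha> h x"
  shows "\<tau> g \<le> \<tau> h"
proof (rule ccontr)
  assume "\<not> \<tau> g \<le> \<tau> h"
  then have "\<tau> (g \<otimes> inv h) > 0" using assms by (simp add: tau_mult tau_inv)
  then have "g \<otimes> inv h \<in> up_elems" using tau_pos_iff assms by blast
  then have "\<alpha> (g \<otimes> inv h) (\<alpha> h x) > \<alpha> h x" by (simp add: up_elems_def)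
  then show False using assms by (simp add: act_mult)
qed

definition devel :: "real \<Rightarrow> real" where
  "devel x = Sup (\<tau> ` {h \<in> carrier G. \<alpha> h 0 \<le> x})"

text \<open>Powers of an element with positive translation number push \<open>x\<close> beyond
  \<open>0\<close> and \<open>0\<close> beyond \<open>x\<close>. The first gives an orbit point of
  \<open>0\<close> below \<open>x\<close>, the second an upper bound by
  \<open>tau_le\<close>.\<close>

lemma devel_ne: "{h \<in> carrier G. \<alpha> h 0 \<le> x} \<noteq> {}"
  and devel_bdd: "bdd_above (\<tau> ` {h \<in> carrier G. \<alpha> h 0 \<le> x})"
proof -
  obtain g where g: "g \<in> carrier G" "\<tau> g > 0" using tau_dense[of 0 1] by auto
  then have "\<forall>x. \<alpha> g x > x" using tau_pos_iff by (simp add: up_elems_def)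
  note unb = orbit_unbounded[OF g(1) this]
  obtain n :: nat where n: "\<alpha> (g [^] n) x > 0" using unb by blast
  then have "\<alpha> (inv (g [^] n)) 0 < x" using g by simp
  then show "{h \<in> carrier G. \<alpha> h 0 \<le> x} \<noteq> {}" using g by (auto intro!: exI[of _ "inv (g [^] n)"] less_imp_le)
  obtain m :: nat where m: "\<alpha> (g [^] m) 0 > x" using unb by blast
  have "\<tau> h \<le> \<tau> (g [^] m)" if "h \<in> carrier G" "\<alpha> h 0 \<le> x" for h
    by (rule tau_le[of _ _ 0]) (use that m g in auto)
  then show "bdd_above (\<tau> ` {h \<in> carrier G. \<alpha> h 0 \<le> x})" by (auto simp: bdd_above_def)
qed

lemma mono_devel: "mono devel"
  unfolding devel_def
  by (intro monoI cSup_subset_mono) (use devel_ne devel_bdd in auto)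

lemma devel_ge: "g \<in> carrier G \<Longrightarrow> devel x + \<tau> g \<le> devel (\<alpha> g x)"
proof -
  assume g: "g \<in> carrier G"
  have "devel x \<le> devel (\<alpha> g x) - \<tau> g"
    unfolding devel_def[of x]
  proof (rule cSup_least)
    fix t assume "t \<in> \<tau> ` {h \<in> carrier G. \<alpha> h 0 \<le> x}"
    then obtain h where h: "h \<in> carrier G" "\<alpha> h 0 \<le> x" "t = \<tau> h" by auto
    have "\<tau> (g \<otimes> h) \<le> devel (\<alpha> g x)"
      unfolding devel_def by (intro cSup_upper devel_bdd) (use g h in \<open>auto simp: act_mult\<close>)
    then show "t \<le> devel (\<alpha> g x) - \<tau> g" using g h by (simp add: tau_mult)
  qed (use devel_ne in auto)
  then show ?thesis by simp
qed

text \<open>The reverse inequality is \<open>devel_ge\<close> for \<open>inv g\<close> at the point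
  \<open>\<alpha> g x\<close>.\<close>

lemma devel_act: "g \<in> carrier G \<Longrightarrow> devel (\<alpha> g x) = devel x + \<tau> g"
  using devel_ge[of g x] devel_ge[of "inv g" "\<alpha> g x"] by (simp add: tau_inv)

text \<open>The image contains a translate of the dense image of \<open>\<tau>\<close>, and a
  monotone map with dense image skips no value: \<open>y\<close> is attained at the supremum of the
  points with value at most \<open>y\<close>.\<close>

lemma surj_devel: "surj devel"
proof -
  have dense: "\<exists>z. u < devel z \<and> devel z < v" if "u < v" for u v
  proof -
    obtain g where "g \<in> carrier G" "u < devel 0 + \<tau> g" "devel 0 + \<tau> g < v"
      using tau_dense[of "u - devel 0" "v - devel 0"] \<open>u < v\<close> by (auto simp: algebra_simps)
    then show ?thesis using devel_act by (intro exI[of _ "\<alpha> g 0"]) simp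
  qed
  have "\<exists>x. devel x = y" for y
  proof -
    define S where "S = {x. devel x \<le> y}"
    obtain x0 where x0: "devel x0 < y" using dense[of "y - 1" y] by auto
    then have ne: "S \<noteq> {}" by (auto simp: S_def intro: less_imp_le)
    obtain x1 where x1: "y < devel x1" using dense[of y "y + 1"] by auto
    have up: "x \<le> z" if "x \<in> S" "y < devel z" for x z
      using that monoD[OF mono_devel, of z x] by (cases "x \<le> z") (auto simp: S_def)
    then have bdd: "bdd_above S" using x1 by (auto simp: bdd_above_def)
    have "devel (Sup S) = y"
    proof (rule ccontr)
      assume "devel (Sup S) \<noteq> y"
      then consider "devel (Sup S) < y" | "y < devel (Sup S)" by linarith
      then show False
      proof cases
        case 1
        then obtain z where z: "devel (Sup S) < devel z" "devel z < y" using dense by blast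
        then have "z \<le> Sup S" by (intro cSup_upper bdd) (simp add: S_def)
        then show False using z monoD[OF mono_devel, of z "Sup S"] by simp
      next
        case 2
        then obtain z where z: "y < devel z" "devel z < devel (Sup S)" using dense by blast
        have "Sup S \<le> z" using up z by (intro cSup_least ne) auto
        then show False using z monoD[OF mono_devel, of "Sup S" z] by simp
      qed
    qed
    then show ?thesis by blast
  qed
  then show ?thesis unfolding surj_def by metis
qed

lemma continuous_on_devel: "continuous_on UNIV devel"
  by (intro continuous_onI_mono) (simp_all add: surj_devel monoD[OF mono_devel])

text \<open>By density some \<open>g\<close> carries \<open>y\<close> to a point left of
  \<open>x\<close> whose \<open>devel\<close> value is within \<open>e\<close> of that of
  \<open>x\<close>. Monotonicity of \<open>F\<close> turns this into an inequality up to
  \<open>e\<close>, and \<open>x\<close> and \<open>y\<close> can be exchanged.\<close>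

lemma equivariant_unique:
  assumes F: "mono F" "\<And>g x. g \<in> carrier G \<Longrightarrow> F (\<alpha> g x) = F x + \<tau> g"
  shows "F x - devel x = F y - devel y"
proof -
  have "F y - devel y \<le> F x - devel x" for x y
  proof (rule field_le_epsilon)
    fix e :: real assume "e > 0"
    then obtain g where g: "g \<in> carrier G" "devel x - devel y - e < \<tau> g" "\<tau> g < devel x - devel y"
      using tau_dense[of "devel x - devel y - e" "devel x - devel y"] by auto
    then have "devel (\<alpha> g y) < devel x" by (simp add: devel_act)
    then have "\<alpha> g y \<le> x" using monoD[OF mono_devel, of x "\<alpha> g y"] by linarith
    then have "F y + \<tau> g \<le> F x" using monoD[OF F(1), of "\<alpha> g y" x] F(2)[OF g(1), of y] by simp
    then show "F y - devel y \<le> F x - devel x + e" using g by simp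
  qed
  then show ?thesis by (meson order_antisym)
qed

end

text \<open>Either \<open>\<tau>\<close> has dense image, or its smallest positive value is preserved by the automorphism
  \<open>T\<close>, which then cannot rescale \<open>\<tau>\<close>.\<close>
lemma (in group) dense_or_unscaled:
  fixes \<tau> :: "'a \<Rightarrow> real"
  assumes tau: "\<And>x y. \<lbrakk>x \<in> carrier G; y \<in> carrier G\<rbrakk> \<Longrightarrow> \<tau> (x \<otimes> y) = \<tau> x + \<tau> y"
    and b: "b \<in> carrier G" "\<tau> b > 0"
    and T: "T ` carrier G = carrier G" "\<And>x. x \<in> carrier G \<Longrightarrow> \<tau> (T x) = l * \<tau> x" and l: "l > 0"
  shows "(\<forall>u v. u < v \<longrightarrow> (\<exists>g\<in>carrier G. u < \<tau> g \<and> \<tau> g < v)) \<or> l = 1"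
proof -
  define S where "S = {\<tau> g | g. g \<in> carrier G \<and> \<tau> g > 0}"
  have S: "S \<noteq> {}" "bdd_below S" using b by (auto simp: S_def bdd_below_def intro: less_imp_le)
  have S_pos: "t > 0" if "t \<in> S" for t using that by (auto simp: S_def)
  have lS: "l * t \<in> S" if t: "t \<in> S" for t
  proof -
    obtain g where "g \<in> carrier G" "t = \<tau> g" "t > 0" using t by (auto simp: S_def)
    then show ?thesis using T l by (auto simp: S_def intro!: exI[of _ "T g"])
  qed
  have Sl: "t / l \<in> S" if t: "t \<in> S" for t
  proof -
    obtain g where g: "g \<in> carrier G" "t = \<tau> g" "t > 0" using t by (auto simp: S_def)
    then obtain h where "h \<in> carrier G" "g = T h" using T(1) by blast
    then show ?thesis using g T(2)[of h] l
      by (auto simp: S_def zero_less_mult_iff intro!: exI[of _ h])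
  qed
  show ?thesis
  proof (cases "Inf S > 0")
    case True
    have "Inf S \<le> t / l" if "t \<in> S" for t using Sl[OF that] S cInf_lower by blast
    then have "l * Inf S \<le> Inf S" using S l by (intro cInf_greatest) (auto simp: field_simps)
    moreover have "Inf S \<le> l * t" if "t \<in> S" for t using lS[OF that] S cInf_lower by blast
    then have "Inf S / l \<le> Inf S" using S l by (intro cInf_greatest) (auto simp: field_simps)
    then have "Inf S \<le> l * Inf S" using l by (simp add: field_simps)
    ultimately show ?thesis using True by simp
  next
    case False
    have "\<exists>g\<in>carrier G. u < \<tau> g \<and> \<tau> g < v" if uv: "u < v" for u v
    proof -
      have "Inf S < v - u" using False uv by linarith
      then obtain s where "s \<in> S" "s < v - u" using cInf_less_iff[OF S] by blast
      then obtain g where g: "g \<in> carrier G" "\<tau> g > 0" "\<tau> g < v - u" by (auto simp: S_def)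
      \<comment> \<open>The first multiple of \<open>\<tau> g\<close> beyond \<open>u\<close>; it
        cannot jump past \<open>v\<close> because \<open>\<tau> g\<close> is smaller than
        \<open>v - u\<close>.\<close>
      define k where "k = \<lfloor>u / \<tau> g\<rfloor> + 1"
      have "of_int k - 1 \<le> u / \<tau> g" "u / \<tau> g < of_int k" unfolding k_def by linarith+
      then have "of_int k * \<tau> g - \<tau> g \<le> u" "u < of_int k * \<tau> g"
        using g by (auto simp: field_simps)
      then show ?thesis using g additive_int_pow[of \<tau>, OF tau g(1), of k]
        by (intro bexI[of _ "g [^] k"]) auto
    qed
    then show ?thesis by blast
  qed
qed

section \<open>Subgroups of rational vector spaces\<close>

locale rat_vec_subgroup =
  fixes d :: nat and H :: "rat vec set"
  assumes subgroup: "subgroup H (monoid_vec TYPE(rat) d)"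
begin

definition K :: "rat vec monoid" where
  "K = (monoid_vec TYPE(rat) d)\<lparr>carrier := H\<rparr>"

lemma K_simps [simp]: "carrier K = H" "monoid.mult K = (+)" "one K = 0\<^sub>v d"
  by (simp_all add: K_def monoid_vec_simps)

lemma H_carrier [simp]: "h \<in> H \<Longrightarrow> h \<in> carrier_vec d"
  using subgroup.subset[OF subgroup] by (auto simp: monoid_vec_simps)

lemma dim_H [simp]: "h \<in> H \<Longrightarrow> dim_vec h = d"
  using carrier_vecD[OF H_carrier] .

lemma comm_group_K: "comm_group K"
proof -
  interpret V: comm_group "monoid_vec TYPE(rat) d"
  proof (rule comm_groupI)
    fix x assume "x \<in> carrier (monoid_vec TYPE(rat) d)"
    then show "\<exists>y\<in>carrier (monoid_vec TYPE(rat) d). y \<otimes>\<^bsub>monoid_vec TYPE(rat) d\<^esub> x = \<one>\<^bsub>monoid_vec TYPE(rat) d\<^esub>"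
      by (intro bexI[of _ "- x"]) (auto simp: monoid_vec_simps)
  qed (auto simp: monoid_vec_simps assoc_add_vec comm_add_vec)
  show ?thesis
    unfolding K_def using subgroup.subgroup_is_group[OF subgroup V.is_group]
    by (rule group.group_comm_groupI) (auto simp: monoid_vec_simps intro!: comm_add_vec[of _ d])
qed

sublocale K: comm_group K
  rewrites "carrier K = H" and "monoid.mult K = (+)" and "one K = 0\<^sub>v d"
  by (simp_all add: comm_group_K)

lemma index_int_pow: "h \<in> H \<Longrightarrow> i < d \<Longrightarrow> (h [^]\<^bsub>K\<^esub> (n::int)) $ i = of_int n * h $ i"
  by (rule K.additive_int_pow[of "\<lambda>h. h $ i"]) auto

text \<open>A filtration of \<open>H\<close> whose successive quotients have rank at most one. It
  serves for induction on the dimension, as \<open>H\<close> need not be finitely generated.\<close>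

definition flag :: "nat \<Rightarrow> rat vec set" where
  "flag k = {h \<in> H. \<forall>i. k \<le> i \<and> i < d \<longrightarrow> h $ i = 0}"

lemma flag_subset: "flag k \<subseteq> H"
  by (auto simp: flag_def)

lemma flag_0: "flag 0 \<subseteq> {0\<^sub>v d}"
  by (auto simp: flag_def intro!: eq_vecI dest: carrier_vecD[OF H_carrier])

lemma flag_d: "flag d = H"
  by (auto simp: flag_def)

text \<open>Modulo \<open>flag k\<close> an element of \<open>flag (Suc k)\<close> is determined by
  its \<open>k\<close>-th coordinate, a rational number. If that of \<open>s\<close> is nonzero, the
  ratio of the coordinates supplies \<open>p\<close> and \<open>q\<close>.\<close>

lemma flag_Suc_cases:
  assumes k: "k < d"
  obtains (same) "flag (Suc k) = flag k"
  | (new) s where "s \<in> H" "s $ k \<noteq> 0" "\<And>i. Suc k \<le> i \<Longrightarrow> i < d \<Longrightarrow> s $ i = 0"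
      "\<And>h. h \<in> flag (Suc k) \<Longrightarrow> \<exists>(q::int) (p::int). \<exists>u\<in>flag k. q > 0 \<and> h [^]\<^bsub>K\<^esub> q = u + s [^]\<^bsub>K\<^esub> p"
proof (cases "\<forall>s\<in>flag (Suc k). s $ k = 0")
  case True
  have "h \<in> flag k" if h: "h \<in> flag (Suc k)" for h
  proof -
    have "h $ i = 0" if "k \<le> i" "i < d" for i
      using True h that by (cases "i = k") (auto simp: flag_def)
    then show ?thesis using h by (simp add: flag_def)
  qed
  then have "flag (Suc k) = flag k" by (auto simp: flag_def)
  then show thesis by (rule same)
next
  case False
  then obtain s where s: "s \<in> flag (Suc k)" "s $ k \<noteq> 0" by auto
  have sH: "s \<in> H" using s flag_subset by auto
  have "\<exists>(q::int) (p::int). \<exists>u\<in>flag k. q > 0 \<and> h [^]\<^bsub>K\<^esub> q = u + s [^]\<^bsub>K\<^esub> p" if h: "h \<in> flag (Suc k)" for h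
  proof -
    have hH: "h \<in> H" using h flag_subset by auto
    obtain p q where pq: "quotient_of (h $ k / s $ k) = (p, q)" by force
    have q: "q > 0" "h $ k / s $ k = of_int p / of_int q"
      using quotient_of_denom_pos[OF pq] quotient_of_div[OF pq] by auto
    define u where "u = h [^]\<^bsub>K\<^esub> q + s [^]\<^bsub>K\<^esub> (- p)"
    have uH: "u \<in> H" using K.m_closed hH sH K.int_pow_closed by (simp add: u_def)
    have ui: "u $ i = of_int q * h $ i - of_int p * s $ i" if "i < d" for i
      using that hH sH H_carrier[OF K.int_pow_closed[OF sH]] index_int_pow
      by (simp add: u_def)
    have "u $ i = 0" if "k \<le> i" "i < d" for i
      using s h q that by (cases "i = k") (auto simp: flag_def ui field_simps)
    then have "u \<in> flag k" using uH by (simp add: flag_def)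
    moreover have "u + s [^]\<^bsub>K\<^esub> p = h [^]\<^bsub>K\<^esub> q"
      unfolding u_def using hH sH K.int_pow_mult[OF sH, of "-p" p]
      by (simp add: K.m_assoc K.r_one)
    ultimately show ?thesis using q(1) by metis
  qed
  then show thesis using new[of s] s sH by (auto simp: flag_def)
qed

text \<open>Induction along the flag: a new element \<open>s\<close> shares a fixed point
  \<open>z\<close> with \<open>flag k\<close>; a positive power of each further \<open>h\<close>
  fixes \<open>z\<close>, and therefore so does \<open>h\<close>.\<close>

lemma common_fixed_point_if_all_elements:
  assumes "comm_line_action K \<alpha>" and fp: "\<And>h. h \<in> H \<Longrightarrow> \<exists>x. \<alpha> h x = x"
  shows "\<exists>x. \<forall>h\<in>H. \<alpha> h x = x"
proof -
  interpret A: comm_line_action K \<alpha> by fact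
  have "\<exists>x. \<forall>h\<in>flag k. \<alpha> h x = x" if "k \<le> d" for k
    using that
  proof (induction k)
    case 0
    show ?case using A.act_one flag_0 by auto
  next
    case (Suc k)
    then obtain x where x: "\<forall>h\<in>flag k. \<alpha> h x = x" by auto
    have "k < d" using Suc by simp
    show ?case
    proof (cases rule: flag_Suc_cases[OF \<open>k < d\<close>, case_names same new])
      case (new s)
      obtain y where "\<alpha> s y = y" using fp new by blast
      then obtain z where z: "\<alpha> s z = z" "\<forall>u\<in>flag k. \<alpha> u z = z"
        using A.common_fixed_point[of s y "flag k" x] flag_subset x new(1) by auto
      have "\<alpha> h z = z" if h: "h \<in> flag (Suc k)" for h
      proof -
        obtain q p :: int and u where u: "u \<in> flag k" "q > 0" "h [^]\<^bsub>K\<^esub> q = u + s [^]\<^bsub>K\<^esub> p"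
          using new(4)[OF h] by blast
        have "\<alpha> (u \<otimes>\<^bsub>K\<^esub> s [^]\<^bsub>K\<^esub> p) z = z"
          using u z new(1) flag_subset A.act_mult[of u "s [^]\<^bsub>K\<^esub> p" z] A.act_int_pow_fixed[of s z p]
          by auto
        then have "\<alpha> (h [^]\<^bsub>K\<^esub> q) z = z" using u(3) by simp
        then show ?thesis using A.act_int_pow_fixed_iff[of h q z] u(2) h flag_subset by auto
      qed
      then show ?thesis by blast
    qed (use x in auto)
  qed
  then show ?thesis using flag_d by blast
qed

text \<open>Induction along the flag, with one new coefficient at each step. Agreement on
  \<open>flag k\<close> and at \<open>s\<close> gives agreement on a positive power of each element,
  and in characteristic zero the exponent can be cancelled.\<close>

lemma additive_is_linear:
  fixes \<tau> :: "rat vec \<Rightarrow> 'f::field_char_0"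
  assumes tau: "\<And>x y. \<lbrakk>x \<in> H; y \<in> H\<rbrakk> \<Longrightarrow> \<tau> (x + y) = \<tau> x + \<tau> y"
  obtains c where "\<And>h. h \<in> H \<Longrightarrow> \<tau> h = (\<Sum>i<d. c i * of_rat (h $ i))"
proof -
  have "\<exists>c. \<forall>h\<in>flag k. \<tau> h = (\<Sum>i<k. c i * of_rat (h $ i))" if "k \<le> d" for k
    using that
  proof (induction k)
    case 0
    show ?case using flag_0 K.additive_one[of \<tau>, OF tau] by auto
  next
    case (Suc k)
    then obtain c where c: "\<forall>h\<in>flag k. \<tau> h = (\<Sum>i<k. c i * of_rat (h $ i))" by auto
    have "k < d" using Suc by simp
    show ?case
    proof (cases rule: flag_Suc_cases[OF \<open>k < d\<close>, case_names same new])
      case same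
      have "\<tau> h = (\<Sum>i<Suc k. c i * of_rat (h $ i))" if "h \<in> flag (Suc k)" for h
      proof -
        have "h \<in> flag k" using that same by simp
        moreover from this have "h $ k = 0" using \<open>k < d\<close> by (auto simp: flag_def)
        ultimately show ?thesis using c by simp
      qed
      then show ?thesis by blast
    next
      case (new s)
      \<comment> \<open>The new coefficient is the one forced by the value at \<open>s\<close>,
        whose \<open>k\<close>-th coordinate is nonzero.\<close>
      define c' where "c' = c(k := (\<tau> s - (\<Sum>i<k. c i * of_rat (s $ i))) / of_rat (s $ k))"
      define \<delta> where "\<delta> h = \<tau> h - (\<Sum>i<Suc k. c' i * of_rat (h $ i))" for h
      have cc: "(\<Sum>i<k. c' i * of_rat (h $ i)) = (\<Sum>i<k. c i * of_rat (h $ i))" for h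
        by (intro sum.cong) (auto simp: c'_def)
      have d_add: "\<delta> (x + y) = \<delta> x + \<delta> y" if "x \<in> H" "y \<in> H" for x y
      proof -
        have "(\<Sum>i<Suc k. c' i * of_rat ((x + y) $ i)) =
            (\<Sum>i<Suc k. c' i * of_rat (x $ i)) + (\<Sum>i<Suc k. c' i * of_rat (y $ i))"
          unfolding sum.distrib[symmetric]
          by (intro sum.cong) (use that \<open>k < d\<close> in \<open>auto simp: of_rat_add algebra_simps\<close>)
        then show ?thesis using that by (simp add: \<delta>_def tau)
      qed
      have d_pow: "\<delta> (x [^]\<^bsub>K\<^esub> n) = of_int n * \<delta> x" if "x \<in> H" for x and n :: int
        using K.additive_int_pow[of \<delta>, OF d_add] that by blast
      have ds: "\<delta> s = 0" using new(2) by (simp add: \<delta>_def cc) (simp add: c'_def)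
      have du: "\<delta> u = 0" if "u \<in> flag k" for u
      proof -
        have "u $ k = 0" using that \<open>k < d\<close> by (auto simp: flag_def)
        then show ?thesis using c that by (simp add: \<delta>_def cc)
      qed
      have "\<delta> h = 0" if h: "h \<in> flag (Suc k)" for h
      proof -
        obtain q p :: int and u where u: "u \<in> flag k" "q > 0" "h [^]\<^bsub>K\<^esub> q = u + s [^]\<^bsub>K\<^esub> p"
          using new(4)[OF h] by blast
        have "of_int q * \<delta> h = \<delta> (h [^]\<^bsub>K\<^esub> q)" using d_pow[OF subsetD[OF flag_subset h]] by simp
        also have "\<dots> = \<delta> u + of_int p * \<delta> s"
          unfolding u(3) using d_add[of u] d_pow[OF new(1)] u(1) flag_subset K.int_pow_closed[OF new(1)]
          by (metis subsetD)
        finally show ?thesis using u(2) ds du[OF u(1)] by simp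
      qed
      then show ?thesis unfolding \<delta>_def by (intro exI[of _ c']) auto
    qed
  qed
  from this[of d] show thesis using that flag_d by auto
qed

text \<open>A nontrivial linear relation expresses one coordinate on \<open>H\<close> through the others, and
  dropping that coordinate embeds \<open>H\<close> into a smaller rational space.\<close>
lemma linear_form_zero:
  fixes c :: "nat \<Rightarrow> 'f::field_char_0"
  assumes rank: "rank_Q K = d" and c: "\<And>h. h \<in> H \<Longrightarrow> (\<Sum>i<d. c i * of_rat (h $ i)) = 0"
    and j: "j < d"
  shows "c j = 0"
proof (rule ccontr)
  assume cj: "c j \<noteq> 0"
  define f where "f h = vec (d - 1) (\<lambda>i. h $ (if i < j then i else Suc i))" for h :: "rat vec"
  have "f \<in> hom K (monoid_vec TYPE(rat) (d - 1))"
    by (rule homI) (auto simp: f_def monoid_vec_simps intro!: eq_vecI)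
  moreover have "inj_on f H"
  proof (rule inj_onI)
    fix x y assume xy: "x \<in> H" "y \<in> H" "f x = f y"
    have coord: "x $ i = y $ i" if "i < d" "i \<noteq> j" for i
    proof (cases "i < j")
      case True
      then have "f x $ i = x $ i" "f y $ i = y $ i" using j by (simp_all add: f_def)
      then show ?thesis using xy by simp
    next
      case False
      then have "f x $ (i - 1) = x $ i" "f y $ (i - 1) = y $ i" using that by (auto simp: f_def)
      then show ?thesis using xy by simp
    qed
    have split: "(\<Sum>i<d. c i * of_rat (h $ i)) = c j * of_rat (h $ j) + (\<Sum>i\<in>{..<d} - {j}. c i * of_rat (h $ i))"
      for h :: "rat vec" using j by (simp add: sum.remove)
    have "(\<Sum>i\<in>{..<d} - {j}. c i * of_rat (x $ i)) = (\<Sum>i\<in>{..<d} - {j}. c i * of_rat (y $ i))"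
      by (intro sum.cong) (auto simp: coord)
    then have "c j * of_rat (x $ j) = c j * of_rat (y $ j)"
      using c[OF xy(1)] c[OF xy(2)] unfolding split by (metis add_right_cancel)
    then have "x $ j = y $ j" using cj by simp
    then show "x = y" using coord xy H_carrier by (intro eq_vecI) (auto simp: carrier_vecD)
  qed
  ultimately have "mon K (monoid_vec TYPE(rat) (d - 1)) \<noteq> {}" by (auto simp: mon_def)
  then have "rank_Q K \<le> d - 1" unfolding rank_Q_def by (rule Least_le)
  then show False using rank j by simp
qed

text \<open>If \<open>c\<close> is the coefficient vector of \<open>\<tau>\<close>, invariance makes
  the form with coefficients \<open>c'\<close>, those of the transpose of \<open>A\<close> applied
  to \<open>c\<close> minus \<open>c\<close>, vanish on \<open>H\<close>. By full rank
  \<open>c' = 0\<close>, so a nonzero \<open>c\<close> would be an eigenvector of the transpose,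
  which has the same characteristic polynomial as \<open>A\<close>.\<close>

lemma invariant_additive_zero:
  fixes \<tau> :: "rat vec \<Rightarrow> complex"
  assumes A: "A \<in> carrier_mat d d" "\<And>h. h \<in> H \<Longrightarrow> A *\<^sub>v h \<in> H"
    and ev: "\<not> eigenvalue (map_mat of_rat A :: complex mat) 1"
    and rank: "rank_Q K = d"
    and tau: "\<And>x y. \<lbrakk>x \<in> H; y \<in> H\<rbrakk> \<Longrightarrow> \<tau> (x + y) = \<tau> x + \<tau> y"
    and inv: "\<And>h. h \<in> H \<Longrightarrow> \<tau> (A *\<^sub>v h) = \<tau> h" and h: "h \<in> H"
  shows "\<tau> h = 0"
proof -
  obtain c where c: "\<And>h. h \<in> H \<Longrightarrow> \<tau> h = (\<Sum>i<d. c i * of_rat (h $ i))"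
    using additive_is_linear[of \<tau>, OF tau] by blast
  define B where "B = (map_mat of_rat A :: complex mat)"
  have B: "B \<in> carrier_mat d d" using A by (simp add: B_def)
  define c' where "c' j = (\<Sum>i<d. c i * of_rat (A $$ (i, j))) - c j" for j
  have "(\<Sum>j<d. c' j * of_rat (h $ j)) = 0" if h: "h \<in> H" for h
  proof -
    have "of_rat ((A *\<^sub>v h) $ i) = (\<Sum>j<d. of_rat (A $$ (i, j)) * of_rat (h $ j) :: complex)"
      if "i < d" for i
      using that A h H_carrier[OF h]
      by (auto simp: scalar_prod_def of_rat_sum of_rat_mult atLeast0LessThan intro!: sum.cong)
    then have "(\<Sum>i<d. c i * of_rat ((A *\<^sub>v h) $ i)) =
        (\<Sum>i<d. \<Sum>j<d. c i * of_rat (A $$ (i, j)) * of_rat (h $ j))"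
      by (simp add: sum_distrib_left mult.assoc)
    also have "\<dots> = (\<Sum>j<d. \<Sum>i<d. c i * of_rat (A $$ (i, j)) * of_rat (h $ j))"
      by (rule sum.swap)
    finally show ?thesis
      using inv[OF h] c[OF h] c[OF A(2)[OF h]]
      by (simp add: c'_def left_diff_distrib sum_distrib_right sum_subtractf)
  qed
  then have c': "c' j = 0" if "j < d" for j using linear_form_zero[OF rank] that by blast
  have "c i = 0" if "i < d" for i
  proof (rule ccontr)
    assume ci: "c i \<noteq> 0"
    define v where "v = vec d c"
    have "v \<noteq> 0\<^sub>v d" using ci that by (auto simp: v_def dest!: arg_cong[of _ _ "\<lambda>v. v $ i"])
    moreover have "transpose_mat B *\<^sub>v v = 1 \<cdot>\<^sub>v v"
    proof (rule eq_vecI)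
      fix j assume "j < dim_vec (1 \<cdot>\<^sub>v v)"
      then have j: "j < d" by (simp add: v_def)
      then have "(transpose_mat B *\<^sub>v v) $ j = (\<Sum>i<d. of_rat (A $$ (i, j)) * c i)"
        using A by (simp add: B_def v_def scalar_prod_def atLeast0LessThan)
      also have "\<dots> = c j" using c'[OF j] by (simp add: c'_def mult.commute)
      finally show "(transpose_mat B *\<^sub>v v) $ j = (1 \<cdot>\<^sub>v v) $ j" using j by (simp add: v_def)
    qed (use B in \<open>simp add: v_def\<close>)
    ultimately have "eigenvector (transpose_mat B) v 1"
      using B by (simp add: eigenvector_def v_def)
    then have "eigenvalue (transpose_mat B) 1" unfolding eigenvalue_def by blast
    then have "eigenvalue B 1"
      using B eigenvalue_root_char_poly[OF B, of 1] eigenvalue_root_char_poly[of "transpose_mat B" d 1]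
      by simp
    then show False using ev by (simp add: B_def)
  qed
  then show ?thesis using c[OF h] by simp
qed

end

section \<open>From the interval to the line\<close>

definition logit :: "real \<Rightarrow> real" where
  "logit x = ln (x / (1 - x))"

definition logistic :: "real \<Rightarrow> real" where
  "logistic y = exp y / (1 + exp y)"

lemma logistic_bounds [simp]: "0 < logistic y" "logistic y < 1" "0 \<le> logistic y" "logistic y \<le> 1"
proof -
  have "1 + exp y > 0" by (simp add: add_pos_pos)
  then show "0 < logistic y" "logistic y < 1" by (simp_all add: logistic_def field_simps)
  then show "0 \<le> logistic y" "logistic y \<le> 1" by simp_all
qed

lemma logit_logistic [simp]: "logit (logistic y) = y"
proof -
  have "1 + exp y > 0" by (simp add: add_pos_pos)
  then have "1 - logistic y = 1 / (1 + exp y)" by (simp add: logistic_def field_simps)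
  then have "logistic y / (1 - logistic y) = exp y"
    using \<open>1 + exp y > 0\<close> by (simp add: logistic_def)
  then show ?thesis by (simp add: logit_def)
qed

lemma logistic_logit [simp]:
  assumes "0 < x" "x < 1"
  shows "logistic (logit x) = x"
proof -
  have "exp (logit x) = x / (1 - x)" using assms by (simp add: logit_def)
  moreover have "1 + x / (1 - x) = 1 / (1 - x)" using assms by (simp add: field_simps)
  ultimately show ?thesis using assms by (simp add: logistic_def)
qed

lemma logit_less:
  assumes "0 < x" "x < y" "y < 1"
  shows "logit x < logit y"
proof -
  have "x / (1 - x) < y / (1 - y)" using assms by (simp add: field_simps)
  then show ?thesis using assms by (simp add: logit_def)
qed

lemma logistic_less: "x < y \<Longrightarrow> logistic x < logistic y"
  using logit_less[of "logistic y" "logistic x"] by (cases "logistic x" "logistic y" rule: linorder_cases) (auto dest: arg_cong[of _ _ logit])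

lemma continuous_on_logit: "continuous_on {0<..<1} logit"
  unfolding logit_def by (intro continuous_intros) auto

lemma acts_on_interval_interior:
  assumes "acts_on_interval G \<phi>" "g \<in> carrier G" "0 < x" "x < 1"
  shows "0 < \<phi> g x" "\<phi> g x < 1"
proof -
  interpret group_action G "{0..1}" \<phi> using assms by (simp add: acts_on_interval_def)
  have mono: "strict_mono_on {0..1} (\<phi> g)"
    using assms by (simp add: acts_on_interval_def orient_pres_homeo_def)
  have "\<phi> g 0 \<in> {0..1}" "\<phi> g 1 \<in> {0..1}" using surj_prop[OF assms(2)] by auto
  moreover have "\<phi> g 0 < \<phi> g x" "\<phi> g x < \<phi> g 1"
    using mono assms by (auto simp: strict_mono_on_def)
  ultimately show "0 < \<phi> g x" "\<phi> g x < 1" by auto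
qed

lemma line_action_of_interval:
  assumes act: "acts_on_interval G \<phi>"
  shows "line_action G (\<lambda>g y. logit (\<phi> g (logistic y)))"
proof -
  interpret group_action G "{0..1}" \<phi> using act by (simp add: acts_on_interval_def)
  interpret group_hom G "BijGroup {0..1}" \<phi> by (rule group_hom)
  note int = acts_on_interval_interior[OF act]
  show ?thesis
  proof unfold_locales
    fix g assume g: "g \<in> carrier G"
    have "strict_mono_on {0..1} (\<phi> g)"
      using act g by (simp add: acts_on_interval_def orient_pres_homeo_def)
    then show "strict_mono (\<lambda>y. logit (\<phi> g (logistic y)))"
      using g int by (intro strict_monoI logit_less) (auto simp: strict_mono_on_def logistic_less)
    fix h x assume h: "h \<in> carrier G"
    show "logit (\<phi> (g \<otimes>\<^bsub>G\<^esub> h) (logistic x)) = logit (\<phi> g (logistic (logit (\<phi> h (logistic x)))))"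
      using composition_rule[of "logistic x" g h] g h int[OF h, of "logistic x"] by simp
  next
    fix x
    \<comment> \<open>The unit of \<open>BijGroup\<close> is the identity restricted to the closed
      interval, where \<open>logistic x\<close> lies.\<close>
    have "\<phi> \<one>\<^bsub>G\<^esub> (logistic x) = (\<lambda>x \<in> {0..1}. x) (logistic x)"
      using id_eq_one by simp
    then show "logit (\<phi> \<one>\<^bsub>G\<^esub> (logistic x)) = x" by simp
  qed
qed

text \<open>Allows affinity of the whole action to be checked on generators only.\<close>

lemma (in line_action) affine_subgroup:
  fixes F :: "real \<Rightarrow> real"
  shows "subgroup {g \<in> carrier G. \<exists>l>0. \<exists>t. \<forall>x. F (\<alpha> g x) = l * F x + t} G"
    (is "subgroup ?S G")
proof (rule subgroupI)
  have affineI: "g \<in> ?S" if "g \<in> carrier G" "l > 0" "\<And>x. F (\<alpha> g x) = l * F x + t" for g l t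
    using that by blast
  have "\<one> \<in> ?S" by (rule affineI[of _ 1 0]) auto
  then show "?S \<noteq> {}" by blast
  fix g assume "g \<in> ?S"
  then obtain l t where g: "g \<in> carrier G" "l > 0" "\<And>x. F (\<alpha> g x) = l * F x + t" by auto
  have "F (\<alpha> (inv g) x) = (1 / l) * F x + (- t / l)" for x
    using g(3)[of "\<alpha> (inv g) x"] g(1,2) by (simp add: field_simps)
  then show "inv g \<in> ?S" using g(1,2) by (intro affineI[of _ "1 / l" "- t / l"]) auto
  fix h assume "h \<in> ?S"
  then obtain l' t' where h: "h \<in> carrier G" "l' > 0" "\<And>x. F (\<alpha> h x) = l' * F x + t'" by auto
  have "F (\<alpha> (g \<otimes> h) x) = (l * l') * F x + (l * t' + t)" for x
    using g h by (simp add: act_mult algebra_simps)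
  then show "g \<otimes> h \<in> ?S" using g(1,2) h(1,2)
    by (intro affineI[of _ "l * l'" "l * t' + t"]) auto
qed auto

text \<open>Since \<open>F\<close> is onto, the affine map belonging to \<open>g\<close> is
  determined by the relation, so the chosen coefficients are automatically multiplicative.\<close>

lemma (in line_action) affine_hom_exists:
  fixes F :: "real \<Rightarrow> real"
  assumes "surj F" and aff: "\<And>g. g \<in> carrier G \<Longrightarrow> \<exists>l>0. \<exists>t. \<forall>x. F (\<alpha> g x) = l * F x + t"
  shows "\<exists>\<psi>\<in>hom G Aff_plus. \<forall>g\<in>carrier G. \<forall>x. F (\<alpha> g x) = \<psi> g (F x)"
proof -
  obtain l t where lt: "\<And>g. g \<in> carrier G \<Longrightarrow> l g > 0 \<and> (\<forall>x. F (\<alpha> g x) = l g * F x + t g)"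
    using aff by metis
  define \<psi> where "\<psi> g = (\<lambda>y. l g * y + t g)" for g
  have \<psi>: "F (\<alpha> g x) = \<psi> g (F x)" if "g \<in> carrier G" for g x
    using lt[OF that] by (simp add: \<psi>_def)
  have "\<psi> \<in> hom G Aff_plus"
  proof (rule homI)
    show "\<psi> g \<in> carrier Aff_plus" if "g \<in> carrier G" for g
      using lt[OF that] by (auto simp: Aff_plus_def \<psi>_def)
    show "\<psi> (g \<otimes> h) = \<psi> g \<otimes>\<^bsub>Aff_plus\<^esub> \<psi> h" if "g \<in> carrier G" "h \<in> carrier G" for g h
    proof
      fix y
      obtain x where "y = F x" using \<open>surj F\<close> by blast
      then show "\<psi> (g \<otimes> h) y = (\<psi> g \<otimes>\<^bsub>Aff_plus\<^esub> \<psi> h) y"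
        using that by (simp add: Aff_plus_def \<psi>[symmetric] act_mult)
    qed
  qed
  then show ?thesis using \<psi> by blast
qed

section \<open>Actions of the semidirect product\<close>

locale semidirect_line_action =
  rat_vec_subgroup d H + line_action "Z_semidirect d A H" \<alpha>
  for d :: nat and A :: "rat mat" and H :: "rat vec set" and \<alpha> +
  assumes A_GLQ: "A \<in> carrier (GLQ d)" and A_H: "(\<lambda>v. A *\<^sub>v v) ` H = H"
begin

abbreviation "G \<equiv> Z_semidirect d A H"

lemma group_GLQ: "group (GLQ d)"
proof -
  interpret ring "ring_mat TYPE(rat) d ()" by (rule ring_mat)
  show ?thesis unfolding GLQ_def by (rule units_group)
qed

lemma A_carrier [simp]: "A \<in> carrier_mat d d"
  using A_GLQ by (simp add: GLQ_def units_of_def Units_def ring_mat_def)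

lemma one_GLQ [simp]: "\<one>\<^bsub>GLQ d\<^esub> = 1\<^sub>m d"
  by (simp add: GLQ_def units_of_def ring_mat_def)

lemma A_pow_1 [simp]: "A [^]\<^bsub>GLQ d\<^esub> (1::int) = A"
  using group.int_pow_1[OF group_GLQ A_GLQ] .

lemma A_mult_H [simp]: "h \<in> H \<Longrightarrow> A *\<^sub>v h \<in> H"
  using A_H by blast

lemma zero_H [simp]: "0\<^sub>v d \<in> H"
  using K.one_closed .

lemma in_G [simp]: "emb_H h \<in> carrier G \<longleftrightarrow> h \<in> H" "gen_a d \<in> carrier G"
  by (simp_all add: Z_semidirect_def emb_H_def gen_a_def)

lemma emb_mult: "u \<in> H \<Longrightarrow> v \<in> H \<Longrightarrow> emb_H (u + v) = emb_H u \<otimes>\<^bsub>G\<^esub> emb_H v"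
  by (simp add: Z_semidirect_def emb_H_def)

lemma emb_zero: "emb_H (0\<^sub>v d) = \<one>\<^bsub>G\<^esub>"
  by (simp add: Z_semidirect_def emb_H_def)

lemma conj_rel: "h \<in> H \<Longrightarrow> gen_a d \<otimes>\<^bsub>G\<^esub> emb_H h = emb_H (A *\<^sub>v h) \<otimes>\<^bsub>G\<^esub> gen_a d"
  using H_carrier[OF A_mult_H, of h] by (simp add: Z_semidirect_def emb_H_def gen_a_def)

text \<open>With the generator on the left, only the first power of \<open>A\<close> occurs,
  whatever the sign of \<open>m\<close>.\<close>

lemma gen_mult: "gen_a d \<otimes>\<^bsub>G\<^esub> (m, 0\<^sub>v d) = (1 + m, 0\<^sub>v d)"
proof -
  have "A *\<^sub>v 0\<^sub>v d = 0\<^sub>v d" by (intro eq_vecI) (simp_all add: carrier_matD[OF A_carrier] scalar_prod_def)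
  then show ?thesis by (simp add: Z_semidirect_def gen_a_def)
qed

lemma gen_pow: "gen_a d [^]\<^bsub>G\<^esub> (m::int) = (m, 0\<^sub>v d)"
proof (induction m rule: int_induct[of _ 0])
  case base
  show ?case by (simp add: Z_semidirect_def)
next
  case (step1 m)
  have "gen_a d [^]\<^bsub>G\<^esub> (1 + m) = gen_a d \<otimes>\<^bsub>G\<^esub> gen_a d [^]\<^bsub>G\<^esub> m"
    using int_pow_mult[of "gen_a d" 1 m] by simp
  then show ?case using step1 gen_mult[of m] by (simp add: add.commute)
next
  case (step2 m)
  have "gen_a d \<otimes>\<^bsub>G\<^esub> gen_a d [^]\<^bsub>G\<^esub> (m - 1) = gen_a d [^]\<^bsub>G\<^esub> m"
    using int_pow_mult[of "gen_a d" 1 "m - 1"] by simp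
  also have "\<dots> = gen_a d \<otimes>\<^bsub>G\<^esub> (m - 1, 0\<^sub>v d)" using step2 gen_mult[of "m - 1"] by simp
  finally have eq: "gen_a d \<otimes>\<^bsub>G\<^esub> gen_a d [^]\<^bsub>G\<^esub> (m - 1) = gen_a d \<otimes>\<^bsub>G\<^esub> (m - 1, 0\<^sub>v d)" .
  have "(m - 1, 0\<^sub>v d) \<in> carrier G" by (simp add: Z_semidirect_def)
  then show ?case using eq by (metis Units_eq Units_l_cancel in_G(2) int_pow_closed)
qed

lemma decompose: "u \<in> H \<Longrightarrow> (m, u) = emb_H u \<otimes>\<^bsub>G\<^esub> gen_a d [^]\<^bsub>G\<^esub> m"
  unfolding gen_pow by (simp add: Z_semidirect_def emb_H_def)

lemma subgroup_eq_G:
  assumes S: "subgroup S G" and "gen_a d \<in> S" "\<And>h. h \<in> H \<Longrightarrow> emb_H h \<in> S"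
  shows "S = carrier G"
proof
  show "carrier G \<subseteq> S"
  proof
    fix g assume "g \<in> carrier G"
    then obtain m u where g: "g = (m, u)" "u \<in> H" by (auto simp: Z_semidirect_def)
    have "gen_a d [^]\<^bsub>G\<^esub> m \<in> S" using subgroup_int_pow_closed[OF S assms(2)] .
    then show "g \<in> S" using subgroup.m_closed[OF S] assms(3) g decompose by metis
  qed
qed (use subgroup.subset[OF S] in blast)

abbreviation "\<beta> h \<equiv> \<alpha> (emb_H h)"

sublocale C: comm_line_action K \<beta>
  rewrites "carrier K = H" and "monoid.mult K = (+)" and "one K = 0\<^sub>v d"
proof -
  show "comm_line_action K \<beta>"
    by unfold_locales (auto simp: act_strict_mono emb_mult act_mult emb_zero)
qed simp_all

section \<open>The generator acting on the dynamics of \<open>H\<close>\<close>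

lemma act_conj: "h \<in> H \<Longrightarrow> \<alpha> (gen_a d) (\<beta> h x) = \<beta> (A *\<^sub>v h) (\<alpha> (gen_a d) x)"
  using act_mult[of "gen_a d" "emb_H h" x] act_mult[of "emb_H (A *\<^sub>v h)" "gen_a d" x] conj_rel[of h]
  by simp

lemma generator_fixed_point_free:
  assumes x: "\<And>h. h \<in> H \<Longrightarrow> \<beta> h x = x" and no: "\<nexists>z. \<forall>g\<in>carrier G. \<alpha> g z = z"
  shows "\<alpha> (gen_a d) y \<noteq> y"
proof
  assume y: "\<alpha> (gen_a d) y = y"
  define C where "C = (\<Inter>h\<in>H. {x. \<beta> h x = x})"
  have "closed C" unfolding C_def by (auto intro!: closed_act_fixed)
  moreover have "C \<noteq> {}" using x by (auto simp: C_def)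
  moreover have "\<alpha> (gen_a d) u \<in> C \<longleftrightarrow> u \<in> C" for u
  proof -
    \<comment> \<open>As \<open>A\<close> maps \<open>H\<close> onto itself, it suffices to test the
      elements \<open>A *\<^sub>v h\<close>, which act at \<open>\<alpha> (gen_a d) u\<close> as
      \<open>h\<close> does at \<open>u\<close>.\<close>
    have "\<alpha> (gen_a d) u \<in> C \<longleftrightarrow> (\<forall>h\<in>H. \<beta> (A *\<^sub>v h) (\<alpha> (gen_a d) u) = \<alpha> (gen_a d) u)"
      unfolding C_def by (subst A_H[symmetric]) simp
    also have "\<dots> \<longleftrightarrow> u \<in> C" by (simp add: C_def act_conj[symmetric])
    finally show ?thesis .
  qed
  ultimately obtain z where z: "z \<in> C" "\<alpha> (gen_a d) z = z"
    using fixed_point_in_invariant_set[OF _ y, of C] by auto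
  have "subgroup {g \<in> carrier G. \<alpha> g z = z} G"
  proof (rule subgroupI)
    have "\<one>\<^bsub>G\<^esub> \<in> {g \<in> carrier G. \<alpha> g z = z}" by simp
    then show "{g \<in> carrier G. \<alpha> g z = z} \<noteq> {}" by blast
  qed (auto simp: act_mult act_inv_eq_iff)
  then have "{g \<in> carrier G. \<alpha> g z = z} = carrier G"
    by (rule subgroup_eq_G) (use z in \<open>auto simp: C_def\<close>)
  then show False using no by blast
qed

text \<open>The action of \<open>A *\<^sub>v h\<close> is that of \<open>h\<close> conjugated by an
  increasing bijection, which preserves the direction of motion.\<close>

lemma A_up_iff: "h \<in> H \<Longrightarrow> A *\<^sub>v h \<in> C.up_elems \<longleftrightarrow> h \<in> C.up_elems"
proof -
  assume h: "h \<in> H"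
  have "(\<forall>x. \<beta> (A *\<^sub>v h) x > x) \<longleftrightarrow> (\<forall>x. \<beta> (A *\<^sub>v h) (\<alpha> (gen_a d) x) > \<alpha> (gen_a d) x)"
    using surj_act[of "gen_a d"] by (metis in_G(2) surjD)
  also have "\<dots> \<longleftrightarrow> (\<forall>x. \<beta> h x > x)" using h by (simp add: act_conj[symmetric])
  finally show ?thesis using h by (simp add: C.up_elems_def)
qed

lemma semiconjugacy_exists:
  assumes no: "\<nexists>x. \<forall>h\<in>H. \<beta> h x = x"
    and ev: "\<not> eigenvalue (map_mat of_rat A :: complex mat) 1" and rank: "rank_Q K = d"
  obtains b F where "b \<in> H" "\<And>x. \<beta> b x \<noteq> x" "mono F" "continuous_on UNIV F" "surj F"
    "\<And>g. g \<in> carrier G \<Longrightarrow> \<exists>l>0. \<exists>t. \<forall>x. F (\<alpha> g x) = l * F x + (t::real)"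
proof -
  have "comm_line_action K \<beta>" by unfold_locales
  then obtain b0 where "b0 \<in> H" "\<forall>x. \<beta> b0 x \<noteq> x"
    using common_fixed_point_if_all_elements no by blast
  \<comment> \<open>Either \<open>b0\<close> or its inverse moves every point to the right.\<close>
  then obtain b where b: "b \<in> C.up_elems" using C.fixed_point_if_not_up by blast
  then have bH: "b \<in> H" "\<beta> b x > x" for x by (auto simp: C.up_elems_def)
  obtain \<tau> :: "rat vec \<Rightarrow> real" where tau_add: "\<And>x y. x \<in> H \<Longrightarrow> y \<in> H \<Longrightarrow> \<tau> (x + y) = \<tau> x + \<tau> y"
    and tau_b: "\<tau> b = 1" and tau_pos: "\<And>x. x \<in> H \<Longrightarrow> \<tau> x > 0 \<longleftrightarrow> x \<in> C.up_elems"
    using C.translation_number_exists[OF b] by blast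
  define l where "l = \<tau> (A *\<^sub>v b)"
  have l: "l > 0" using tau_pos A_up_iff b bH(1) by (simp add: l_def)
  have A_add: "A *\<^sub>v (x + y) = A *\<^sub>v x + A *\<^sub>v y" if "x \<in> H" "y \<in> H" for x y
    using that A_carrier by (meson H_carrier mult_add_distrib_mat_vec)
  \<comment> \<open>By \<open>A_up_iff\<close> the maps \<open>\<tau>\<close> and
    \<open>\<tau>\<close> composed with \<open>A\<close> have the same positive elements, so they
    are proportional; since \<open>\<tau> b = 1\<close>, the factor is the value at
    \<open>A *\<^sub>v b\<close>.\<close>
  have tau_A: "\<tau> (A *\<^sub>v h) = l * \<tau> h" if "h \<in> H" for h
    unfolding l_def
    by (rule K.additive_eq_if_same_positives[of "\<lambda>h. \<tau> (A *\<^sub>v h)"])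
      (use that tau_add tau_b bH(1) in \<open>auto simp: A_add tau_pos A_up_iff\<close>)
  have "l \<noteq> 1"
  proof
    assume "l = 1"
    have "complex_of_real (\<tau> b) = 0"
      by (rule invariant_additive_zero[OF A_carrier A_mult_H ev rank])
        (use bH(1) \<open>l = 1\<close> in \<open>auto simp: tau_add tau_A\<close>)
    then show False using tau_b by simp
  qed
  then have dense: "\<exists>g\<in>H. u < \<tau> g \<and> \<tau> g < v" if "u < v" for u v
    using K.dense_or_unscaled[OF tau_add bH(1) _ A_H tau_A l] tau_b that by auto
  interpret D: dense_translation_number K \<beta> \<tau>
    rewrites "carrier K = H" and "monoid.mult K = (+)" and "one K = 0\<^sub>v d"
    by (unfold_locales) (use tau_add tau_pos dense in \<open>simp_all\<close>)
  have gen: "\<exists>t. \<forall>x. D.devel (\<alpha> (gen_a d) x) = l * D.devel x + t"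
  proof -
    \<comment> \<open>Conjugation by the generator multiplies translation numbers by
      \<open>l\<close>; dividing by \<open>l\<close> makes \<open>F\<close> equivariant for
      \<open>\<tau>\<close> itself, hence equal to \<open>devel\<close> up to a constant.\<close>
    define F where "F x = D.devel (\<alpha> (gen_a d) x) / l" for x
    have "mono F"
      using l by (auto simp: F_def intro!: monoI divide_right_mono monoD[OF D.mono_devel])
    moreover have "F (\<beta> h x) = F x + \<tau> h" if "h \<in> H" for h x
      using that l by (simp add: F_def act_conj D.devel_act tau_A add_divide_distrib)
    ultimately have "F x - D.devel x = F 0 - D.devel 0" for x
      by (rule D.equivariant_unique)
    then have F_eq: "F x = D.devel x + (F 0 - D.devel 0)" for x by (simp add: algebra_simps)
    have "D.devel (\<alpha> (gen_a d) x) = l * D.devel x + l * (F 0 - D.devel 0)" for x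
    proof -
      have "D.devel (\<alpha> (gen_a d) x) = l * F x" using l by (simp add: F_def)
      also have "\<dots> = l * D.devel x + l * (F 0 - D.devel 0)" by (subst F_eq) (rule distrib_left)
      finally show ?thesis .
    qed
    then show ?thesis by blast
  qed
  have "{g \<in> carrier G. \<exists>l>0. \<exists>t. \<forall>x. D.devel (\<alpha> g x) = l * D.devel x + t} = carrier G"
  proof (rule subgroup_eq_G[OF affine_subgroup])
    \<comment> \<open>Elements of \<open>H\<close> act through \<open>devel\<close> as translations,
      with slope \<open>1\<close>.\<close>
    show "emb_H h \<in> {g \<in> carrier G. \<exists>l>0. \<exists>t. \<forall>x. D.devel (\<alpha> g x) = l * D.devel x + t}"
      if "h \<in> H" for h
    proof (intro CollectI conjI exI)
      show "emb_H h \<in> carrier G" "(0::real) < 1" using that by simp_all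
      show "\<forall>x. D.devel (\<beta> h x) = 1 * D.devel x + \<tau> h" using that by (simp add: D.devel_act)
    qed
  qed (use gen l in auto)
  then have "\<exists>l>0. \<exists>t. \<forall>x. D.devel (\<alpha> g x) = l * D.devel x + t" if "g \<in> carrier G" for g
    using that by blast
  then show thesis
    using that[of b D.devel] bH D.mono_devel D.continuous_on_devel D.surj_devel
    by (metis less_irrefl)
qed

end

section \<open>The dichotomy, carried back from the line to the interval\<close>

theorem lemma1p4:
  fixes d :: nat
    and A :: "rat mat"
    and H :: "rat vec set"
    and \<phi> :: "int \<times> rat vec \<Rightarrow> real \<Rightarrow> real"
  assumes "d \<ge> 1"
    and "A \<in> carrier (GLQ d)"
    and "\<And>k :: complex. eigenvalue (map_mat of_rat A) k \<Longrightarrow> norm k \<noteq> 1"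
    and "subgroup H (monoid_vec TYPE(rat) d)"
    and "(\<lambda>v. A *\<^sub>v v) ` H = H"
    and "rank_Q ((monoid_vec TYPE(rat) d)\<lparr>carrier := H\<rparr>) = d"
    and "acts_on_interval (Z_semidirect d A H) \<phi>"
    and "\<not> has_global_fixed_point \<phi> (carrier (Z_semidirect d A H))"
  shows "((\<exists>b\<in>H. \<forall>x\<in>{0<..<1}. \<phi> (emb_H b) x \<noteq> x) \<and> semiconjugate_to_affine (Z_semidirect d A H) \<phi>)
       \<or> (has_global_fixed_point \<phi> (emb_H ` H) \<and> (\<forall>x\<in>{0<..<1}. \<phi> (gen_a d) x \<noteq> x))"
proof -
  define \<alpha> where "\<alpha> = (\<lambda>g y. logit (\<phi> g (logistic y)))"
  interpret L: line_action "Z_semidirect d A H" \<alpha>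
    unfolding \<alpha>_def by (rule line_action_of_interval) fact
  interpret semidirect_line_action d A H \<alpha>
    by (intro semidirect_line_action.intro rat_vec_subgroup.intro semidirect_line_action_axioms.intro
        L.line_action_axioms assms)
  note int = acts_on_interval_interior[OF assms(7)]
  have conj: "\<alpha> g (logit x) = logit (\<phi> g x)" if "0 < x" "x < 1" for g x
    using that by (simp add: \<alpha>_def)
  have fix_iff: "\<phi> g x = x \<longleftrightarrow> \<alpha> g (logit x) = logit x" if "0 < x" "x < 1" "g \<in> carrier G" for g x
    using that int[of g x] conj[of x g] logistic_logit by metis
  have gfp: "has_global_fixed_point \<phi> S \<longleftrightarrow> (\<exists>y. \<forall>g\<in>S. \<alpha> g y = y)" if S: "S \<subseteq> carrier G" for S
  proof
    assume "has_global_fixed_point \<phi> S"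
    then show "\<exists>y. \<forall>g\<in>S. \<alpha> g y = y" using fix_iff S by (fastforce simp: has_global_fixed_point_def)
  next
    assume "\<exists>y. \<forall>g\<in>S. \<alpha> g y = y"
    then obtain y where y: "\<forall>g\<in>S. \<alpha> g y = y" by blast
    have "\<forall>g\<in>S. \<phi> g (logistic y) = logistic y" using y S fix_iff[of "logistic y"] by auto
    then show "has_global_fixed_point \<phi> S"
      unfolding has_global_fixed_point_def by (intro bexI[of _ "logistic y"]) auto
  qed
  have H_G: "emb_H ` H \<subseteq> carrier G" by auto
  show ?thesis
  proof (cases "has_global_fixed_point \<phi> (emb_H ` H)")
    case True
    then obtain y where y: "\<And>h. h \<in> H \<Longrightarrow> \<alpha> (emb_H h) y = y" using gfp[OF H_G] by auto
    have "\<nexists>z. \<forall>g\<in>carrier G. \<alpha> g z = z" using assms(8) gfp[of "carrier G"] by blast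
    then have "\<alpha> (gen_a d) z \<noteq> z" for z using generator_fixed_point_free[OF y] by blast
    then have "\<forall>x\<in>{0<..<1}. \<phi> (gen_a d) x \<noteq> x" using fix_iff[of _ "gen_a d"] by auto
    then show ?thesis using True by blast
  next
    case False
    then have no: "\<nexists>x. \<forall>h\<in>H. \<alpha> (emb_H h) x = x" using gfp[OF H_G] by auto
    have ev: "\<not> eigenvalue (map_mat of_rat A :: complex mat) 1" using assms(3)[of 1] by auto
    have rank: "rank_Q K = d" using assms(6) by (simp add: K_def)
    obtain b F where b: "b \<in> H" "\<And>x. \<alpha> (emb_H b) x \<noteq> x"
      and F: "mono F" "continuous_on UNIV F" "surj F"
        "\<And>g. g \<in> carrier G \<Longrightarrow> \<exists>l>0. \<exists>t. \<forall>x. F (\<alpha> g x) = l * F x + (t::real)"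
      by (rule semiconjugacy_exists[OF no ev rank that])
    obtain \<psi> where \<psi>: "\<psi> \<in> hom G Aff_plus" "\<And>g x. g \<in> carrier G \<Longrightarrow> F (\<alpha> g x) = \<psi> g (F x)"
      using L.affine_hom_exists[OF F(3,4)] by blast
    \<comment> \<open>\<open>logit\<close> conjugates \<open>\<phi>\<close> on the open interval to
      \<open>\<alpha>\<close>, so precomposing \<open>F\<close> with it gives the map on the
      interval.\<close>
    have "semiconjugate_to_affine G \<phi>"
      unfolding semiconjugate_to_affine_def
    proof (intro bexI[OF _ \<psi>(1)] exI[of _ "F \<circ> logit"] conjI ballI)
      show "continuous_on {0<..<1} (F \<circ> logit)"
        by (intro continuous_on_compose continuous_on_logit continuous_on_subset[OF F(2)]) simp
      show "mono_on {0<..<1} (F \<circ> logit)"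
      proof (rule mono_onI)
        fix r s :: real assume "r \<in> {0<..<1}" "s \<in> {0<..<1}" "r \<le> s"
        then have "logit r \<le> logit s" using logit_less[of r s] by (cases "r = s") auto
        then show "(F \<circ> logit) r \<le> (F \<circ> logit) s" using monoD[OF F(1)] by simp
      qed
      have "y \<in> (F \<circ> logit) ` {0<..<1}" for y
      proof -
        obtain x where "y = F x" using F(3) by blast
        then show ?thesis by (intro image_eqI[of _ _ "logistic x"]) auto
      qed
      then show "(F \<circ> logit) ` {0<..<1} = UNIV" by blast
      show "(F \<circ> logit) (\<phi> g x) = \<psi> g ((F \<circ> logit) x)" if "g \<in> carrier G" "x \<in> {0<..<1}" for g x
        using that \<psi>(2)[of g "logit x"] conj[of x g] by simp
    qed
    moreover have "\<forall>x\<in>{0<..<1}. \<phi> (emb_H b) x \<noteq> x" using b fix_iff[of _ "emb_H b"] by auto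
    ultimately show ?thesis using b(1) by blast
  qed
qed

end
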